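(* Consider the multi-agent system and the predictor-like protocol described in the context, with $N\ge 2$ agents. Assume: (i) all eigenvalues of $A$ are on or outside the unit circle, and $B$ has full column rank; (ii) $(A,B,0,A^dB)$ is mean-square stabilizable; (iii) the undirected graph $\mathcal{G}$ is connected. Let $Q>0$ and $R>0$ be symmetric matrices of sizes $n\times n$ and $m\times m$, and let $$\gamma_c=\inf\{\gamma\in[0,1] : \text{there exists } P>0 \text{ with } P=g_\gamma(P)\},$$ $$g_\gamma(P)=A'PA+Q-\gamma A'PB\big[R+B'PB+B'(A')^dPA^dB\big]^{-1}B'PA .$$ Let $$\gamma_2=\frac{\mu^2}{\mu^2+\sigma^2}\left[1-\left(\frac{\lambda_N(L_G)-\lambda_2(L_G)}{\lambda_N(L_G)+\lambda_2(L_G)}\right)^2\right].$$ If $\gamma_2>\gamma_c$, then the multi-agent system is mean-square consensusable under the predictor-like protocol.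
   Context: Notation: $M'$ is the transpose of $M$; for symmetric $M$, $M>0$ ($M\ge0$) means positive definite (semidefinite). Graph: $\mathcal{G}$ is an undirected graph on vertices $\{1,\dots,N\}$ with symmetric weighted adjacency matrix $\mathcal{A}=[a_{ij}]$, $a_{ij}\ge 0$, and $a_{ij}>0$ iff $(i,j)$ is an edge. $N_i$ is the set of neighbours of $i$. The Laplacian is $L_G=\mathcal{D}-\mathcal{A}$ with $\mathcal{D}=\mathrm{diag}(d_1,\dots,d_N)$, $d_i=\sum_j a_{ij}$. Its eigenvalues are ordered $0=\lambda_1(L_G)\le\lambda_2(L_G)\le\cdots\le\lambda_N(L_G)$. System: for $i=1,\dots,N$ and $k\ge0$, $$x_i(k+1)=Ax_i(k)+\gamma(k)Bu_i(k-d),$$ with $x_i\in\mathbb{R}^n$, $u_i\in\mathbb{R}^m$, constant real matrices $A,B$, integer delay $d\ge0$, and $\{\gamma(k)\}_{k\ge0}$ i.i.d. Bernoulli (the same process for all agents) with $P(\gamma(k)=0)=p$, $P(\gamma(k)=1)=1-p$, $p\in(0,1)$. The initial values $x_i(0),u_i(-1),\dots,u_i(-d)$ are given. Put $\mu=1-p$, $\sigma^2=p(1-p)$. Predictor-like protocol with gain $K\in\mathbb{R}^{m\times n}$: for $k\ge d$, $$\hat x_i(k|k-d)=A^dx_i(k-d)+\mu\sum_{j=1}^{d}A^{j-1}Bu_i(k-d-j),$$ $$u_i(k-d)=K\sum_{j\in N_i}a_{ij}\big[\hat x_j(k|k-d)-\hat x_i(k|k-d)\big].$$ Mean-square consensusable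 under the protocol: there exists a gain $K$ such that, for any finite initial values, the protocol yields $\lim_{k\to\infty}E\|x_j(k)-x_i(k)\|^2=0$ for all $i,j$. $(A,B,0,A^dB)$ is mean-square stabilizable if there is a constant matrix $K$ such that with $u(k)=Kx(k)$ the system $x(k+1)=Ax(k)+Bu(k)+\nu(k)A^dBu(k)$, where $\nu(k)$ is white noise with zero mean and unit covariance, satisfies $\lim_{k\to\infty}E\|x(k)\|^2=0$ for every initial state. *)

theory Defs
  imports "HOL-Probability.Probability" "HOL-Computational_Algebra.Computational_Algebra"
begin

section \<open>Matrices\<close>

text \<open>The power operation \<open>^\<close> on \<open>real ^ 'n ^ 'n\<close> is componentwise, hence a separate matrix power.\<close>

primrec matpow :: "real ^ 'n ^ 'n \<Rightarrow> nat \<Rightarrow> real ^ 'n ^ 'n" where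
  "matpow A 0 = mat 1"
| "matpow A (Suc k) = A ** matpow A k"

definition pos_def :: "real ^ 'n ^ 'n \<Rightarrow> bool" where
  "pos_def M \<longleftrightarrow> transpose M = M \<and> (\<forall>x. x \<noteq> 0 \<longrightarrow> x \<bullet> (M *v x) > 0)"

definition eigenvalue :: "complex ^ 'n ^ 'n \<Rightarrow> complex \<Rightarrow> bool" where
  "eigenvalue M z \<longleftrightarrow> (\<exists>v. v \<noteq> 0 \<and> M *v v = z *s v)"

definition charpoly :: "real ^ 'n ^ 'n \<Rightarrow> real poly" where
  "charpoly M = det (\<chi> i j. (if i = j then [:0, 1:] else 0) - [:M $ i $ j:])"

text \<open>
  The \<open>k\<close>-th smallest real eigenvalue, counted with multiplicity, for \<open>1 \<le> k \<le> CARD('n)\<close>.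
  It is only used for symmetric matrices, all of whose eigenvalues are real.
\<close>

definition eigval :: "nat \<Rightarrow> real ^ 'n ^ 'n \<Rightarrow> real" where
  "eigval k M = sorted_list_of_multiset (proots (charpoly M)) ! (k - 1)"


section \<open>Weighted undirected graphs\<close>

text \<open>A graph on the vertex type \<open>'v\<close> is given by its weighted adjacency matrix.\<close>

definition weighted_graph :: "real ^ 'v ^ 'v \<Rightarrow> bool" where
  "weighted_graph a \<longleftrightarrow> transpose a = a \<and> (\<forall>i j. a $ i $ j \<ge> 0)"

definition neighbours :: "real ^ 'v ^ 'v \<Rightarrow> 'v \<Rightarrow> 'v set" where
  "neighbours a i = {j. a $ i $ j > 0}"

definition connected_graph :: "real ^ 'v ^ 'v \<Rightarrow> bool" where
  "connected_graph a \<longleftrightarrow> (\<forall>i j. (i, j) \<in> {(i, j). j \<in> neighbours a i}\<^sup>*)"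

definition laplacian :: "real ^ 'v ^ 'v \<Rightarrow> real ^ 'v ^ 'v" where
  "laplacian a = (\<chi> i j. if i = j then \<Sum>l\<in>UNIV. a $ i $ l else 0) - a"


section \<open>Random sequences and mean-square convergence\<close>

definition bernoulli_process :: "'a measure \<Rightarrow> real \<Rightarrow> (nat \<Rightarrow> 'a \<Rightarrow> real) \<Rightarrow> bool" where
  "bernoulli_process M p \<gamma> \<longleftrightarrow>
     prob_space M \<and> prob_space.indep_vars M (\<lambda>_. borel) \<gamma> UNIV \<and>
     (\<forall>k. measure M {\<omega> \<in> space M. \<gamma> k \<omega> = 0} = p \<and>
          measure M {\<omega> \<in> space M. \<gamma> k \<omega> = 1} = 1 - p)"

text \<open>
  Whiteness is read as independence over time, as is usual for multiplicative noise. The last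
  equation forces square integrability, because the integral of a non-integrable function is \<open>0\<close>.
\<close>

definition white_noise :: "'a measure \<Rightarrow> (nat \<Rightarrow> 'a \<Rightarrow> real) \<Rightarrow> bool" where
  "white_noise M \<nu> \<longleftrightarrow>
     prob_space M \<and> prob_space.indep_vars M (\<lambda>_. borel) \<nu> UNIV \<and>
     (\<forall>k. (\<integral>\<omega>. \<nu> k \<omega> \<partial>M) = 0 \<and> (\<integral>\<omega>. (\<nu> k \<omega>)\<^sup>2 \<partial>M) = 1)"

text \<open>
  The expectation is taken in the extended nonnegative reals, so that a non-integrable squared
  norm has expectation \<open>\<infinity>\<close> rather than the default value \<open>0\<close> of the Bochner integral.
\<close>

definition ms_tendsto_zero :: "'a measure \<Rightarrow> (nat \<Rightarrow> 'a \<Rightarrow> real ^ 'n) \<Rightarrow> bool" where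
  "ms_tendsto_zero M y \<longleftrightarrow>
     (\<lambda>k. \<integral>\<^sup>+ \<omega>. ennreal ((norm (y k \<omega>))\<^sup>2) \<partial>M) \<longlonglongrightarrow> 0"

text \<open>
  Stabilizability of \<open>(A, B, C, D)\<close>, i.e. of
  \<open>x(k+1) = A x(k) + B u(k) + \<nu>(k) (C x(k) + D u(k))\<close>.
\<close>

definition ms_stabilizable ::
  "'a measure \<Rightarrow> (nat \<Rightarrow> 'a \<Rightarrow> real) \<Rightarrow> real ^ 'n ^ 'n \<Rightarrow> real ^ 'm ^ 'n \<Rightarrow> real ^ 'n ^ 'n \<Rightarrow>
   real ^ 'm ^ 'n \<Rightarrow> bool" where
  "ms_stabilizable M \<nu> A B C D \<longleftrightarrow>
     (\<exists>K. \<forall>x0 x.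
        (\<forall>\<omega>\<in>space M. x 0 \<omega> = x0 \<and>
           (\<forall>k. let u = K *v x k \<omega> in
              x (Suc k) \<omega> = A *v x k \<omega> + B *v u + \<nu> k \<omega> *\<^sub>R (C *v x k \<omega> + D *v u)))
        \<longrightarrow> ms_tendsto_zero M x)"


section \<open>The multi-agent system under the predictor-like protocol\<close>

text \<open>
  \<open>predictor A B d p x u k\<close> is \<open>\<hat>x(k|k-d)\<close> for one agent. States are indexed by \<open>nat\<close>, inputs by
  \<open>int\<close> because of the initial inputs \<open>u(-1), \<dots>, u(-d)\<close>. It is only used for \<open>k \<ge> d\<close>, where
  \<open>k - d\<close> is not truncated.
\<close>

definition predictor ::
  "real ^ 'n ^ 'n \<Rightarrow> real ^ 'm ^ 'n \<Rightarrow> nat \<Rightarrow> real \<Rightarrow> (nat \<Rightarrow> real ^ 'n) \<Rightarrow> (int \<Rightarrow> real ^ 'm) \<Rightarrow>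
   nat \<Rightarrow> real ^ 'n" where
  "predictor A B d p x u k =
     matpow A d *v x (k - d) +
     (1 - p) *\<^sub>R (\<Sum>j=1..d. matpow A (j - 1) *v (B *v u (int k - int d - int j)))"

text \<open>
  Sample paths \<open>x\<close>, \<open>u\<close> of the closed loop for the realisation \<open>\<gamma>\<close> of the Bernoulli process. The
  equations determine \<open>x\<close> and the inputs at nonnegative times recursively from the initial values.
\<close>

definition closed_loop ::
  "real ^ 'v ^ 'v \<Rightarrow> real ^ 'n ^ 'n \<Rightarrow> real ^ 'm ^ 'n \<Rightarrow> nat \<Rightarrow> real \<Rightarrow> real ^ 'n ^ 'm \<Rightarrow>
   (nat \<Rightarrow> real) \<Rightarrow> ('v \<Rightarrow> nat \<Rightarrow> real ^ 'n) \<Rightarrow> ('v \<Rightarrow> int \<Rightarrow> real ^ 'm) \<Rightarrow> bool" where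
  "closed_loop a A B d p K \<gamma> x u \<longleftrightarrow>
     (\<forall>i k. x i (Suc k) = A *v x i k + \<gamma> k *\<^sub>R (B *v u i (int k - int d))) \<and>
     (\<forall>i. \<forall>k\<ge>d. u i (int k - int d) =
        K *v (\<Sum>j\<in>neighbours a i. a $ i $ j *\<^sub>R
                (predictor A B d p (x j) (u j) k - predictor A B d p (x i) (u i) k)))"

definition ms_consensusable ::
  "'a measure \<Rightarrow> (nat \<Rightarrow> 'a \<Rightarrow> real) \<Rightarrow> real ^ 'v ^ 'v \<Rightarrow> real ^ 'n ^ 'n \<Rightarrow> real ^ 'm ^ 'n \<Rightarrow> nat \<Rightarrow>
   real \<Rightarrow> bool" where
  "ms_consensusable M \<gamma> a A B d p \<longleftrightarrow>
     (\<exists>K. \<forall>x0 u0 x u.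
        (\<forall>\<omega>\<in>space M.
           (\<forall>i. x i 0 \<omega> = x0 i \<and> (\<forall>s\<in>{1..d}. u i (- int s) \<omega> = u0 i s)) \<and>
           closed_loop a A B d p K (\<lambda>k. \<gamma> k \<omega>) (\<lambda>i k. x i k \<omega>) (\<lambda>i t. u i t \<omega>))
        \<longrightarrow> (\<forall>i j. ms_tendsto_zero M (\<lambda>k \<omega>. x j k \<omega> - x i k \<omega>)))"


section \<open>The modified Riccati equation and the critical values\<close>

definition riccati_map ::
  "real ^ 'n ^ 'n \<Rightarrow> real ^ 'm ^ 'n \<Rightarrow> nat \<Rightarrow> real ^ 'n ^ 'n \<Rightarrow> real ^ 'm ^ 'm \<Rightarrow> real \<Rightarrow>
   real ^ 'n ^ 'n \<Rightarrow> real ^ 'n ^ 'n" where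
  "riccati_map A B d Q R g P =
     transpose A ** P ** A + Q -
     g *\<^sub>R (transpose A ** P ** B **
       matrix_inv (R + transpose B ** P ** B +
         transpose B ** matpow (transpose A) d ** P ** matpow A d ** B) **
       transpose B ** P ** A)"

text \<open>
  An infimum of reals, thus unspecified on the empty set; the set contains \<open>1\<close> whenever
  \<open>(A, B, 0, A\<^sup>d B)\<close> is mean-square stabilizable and \<open>Q\<close>, \<open>R\<close> are positive definite.
\<close>

definition gamma_c ::
  "real ^ 'n ^ 'n \<Rightarrow> real ^ 'm ^ 'n \<Rightarrow> nat \<Rightarrow> real ^ 'n ^ 'n \<Rightarrow> real ^ 'm ^ 'm \<Rightarrow> real" where
  "gamma_c A B d Q R = Inf {g \<in> {0..1}. \<exists>P. pos_def P \<and> P = riccati_map A B d Q R g P}"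

definition gamma_2 :: "real \<Rightarrow> real ^ 'v ^ 'v \<Rightarrow> real" where
  "gamma_2 p a =
     (let \<mu> = 1 - p; \<sigma>2 = p * (1 - p);
          l2 = eigval 2 (laplacian a); lN = eigval CARD('v) (laplacian a)
      in \<mu>\<^sup>2 / (\<mu>\<^sup>2 + \<sigma>2) * (1 - ((lN - l2) / (lN + l2))\<^sup>2))"

end

theory Submission
  imports Defs
begin

text \<open>
  Put \<open>D = A\<^sup>d B\<close>, \<open>\<mu> = 1 - p\<close>, \<open>s = p (1 - p)\<close>. Projecting the network on an orthonormal eigenbasis
  of the Laplacian decouples it into one delayed loop per eigenvalue \<open>l\<close>, and the constant
  eigenvector, with \<open>l = 0\<close>, does not contribute to the disagreement. In a mode with \<open>l > 0\<close> the
  prediction \<open>y(t) = \<hat>x(t+d|t)\<close> satisfies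
  \<open>y(t+1) = A y(t) + \<mu> B u(t) + (\<gamma>(t) - \<mu>) D u(t-d)\<close> with \<open>u(t) = - l K y(t)\<close>, in which the
  noise is centred and independent of the past. So the delay matters only through \<open>D\<close>, and mean-square
  stability follows from a matrix \<open>P > 0\<close> with
  \<open>(A - \<mu> l B K)' P (A - \<mu> l B K) + s l\<^sup>2 K' D' P D K < P\<close>. A solution \<open>P\<close> of the modified Riccati
  equation for some \<open>g < \<gamma>\<^sub>2\<close> does this for all nonzero eigenvalues at once, with
  \<open>K = \<kappa> (R + B' P B + D' P D)\<^sup>-\<^sup>1 B' P A\<close> and \<open>\<kappa> = 2 / (\<lambda>\<^sub>2 + \<lambda>\<^sub>N)\<close>. Such a \<open>g\<close> exists because the
  infimum defining \<open>\<gamma>\<^sub>c\<close> is over a nonempty set: stabilizability bounds value iteration at \<open>g = 1\<close>.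
\<close>

no_notation fps_nth (infixl "$" 75)


section \<open>Quadratic forms and the modified Riccati equation\<close>

text \<open>The prediction \<open>y(t)\<close> is the conditional mean of \<open>x(t+d)\<close>: at
  time \<open>t\<close> the inputs \<open>u(t-1), ..., u(t-d)\<close> are fixed and only their
  channel coefficients are still random. Learning \<open>\<gamma>(t)\<close> corrects the oldest of
  them, whose effect is propagated by \<open>A\<^sup>d\<close>; this is where \<open>D\<close> comes
  from. The obstacle is that for \<open>d > 0\<close> the noise multiplies an old input, so
  \<open>P\<close> alone need not be a Lyapunov function for \<open>y\<close>. In mean square,
  however, each input contributes its noise term once, so the price can be booked when the input is
  issued, and this restores a condition without delay. Projection is compatible with the random
  channel because all agents share the same \<open>\<gamma>\<close>. The bound
  \<open>\<gamma>\<^sub>2\<close> is a minimax value. In mode \<open>l\<close> the gain acts through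
  \<open>c = l \<kappa>\<close>, and the Riccati equation pays for it if \<open>g\<close> is at most
  \<open>2 \<mu> c - (\<mu>\<^sup>2 + s) c\<^sup>2 = \<mu> (1 - (1 - c)\<^sup>2)\<close>. A single
  \<open>\<kappa>\<close> has to keep \<open>c\<close> close to 1 for all nonzero eigenvalues, and
  the best worst-case distance is \<open>(\<lambda>\<^sub>N - \<lambda>\<^sub>2) /
  (\<lambda>\<^sub>N + \<lambda>\<^sub>2)\<close>.\<close>

definition qform :: "real ^ 'n ^ 'n \<Rightarrow> real ^ 'n \<Rightarrow> real" where
  "qform M x = x \<bullet> (M *v x)"

definition pos_semidef :: "real ^ 'n ^ 'n \<Rightarrow> bool" where
  "pos_semidef M \<longleftrightarrow> transpose M = M \<and> (\<forall>x. 0 \<le> qform M x)"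

lemma inner_transpose_mult: "x \<bullet> (transpose M *v y) = (M *v x) \<bullet> y"
  for M :: "real ^ 'n ^ 'm"
  by (metis dot_lmul_matrix inner_commute transpose_matrix_vector)

lemma inner_symmetric_mult:
  "transpose M = M \<Longrightarrow> x \<bullet> (M *v y) = (M *v x) \<bullet> y" for M :: "real ^ 'n ^ 'n"
  by (metis inner_transpose_mult)

lemma symmetric_matrixI:
  fixes M :: "real ^ 'n ^ 'n"
  assumes "\<And>x y. x \<bullet> (M *v y) = y \<bullet> (M *v x)"
  shows "transpose M = M"
proof -
  have "x \<bullet> (transpose M *v y) = x \<bullet> (M *v y)" for x y
    unfolding inner_transpose_mult using assms[of y x] by (simp add: assms inner_commute)
  then have "transpose M *v y = M *v y" for y
    using vector_eq_ldot by blast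
  then show ?thesis
    by (simp only: matrix_eq simp_thms)
qed

lemma qform_0 [simp]: "qform M 0 = 0"
  by (simp add: qform_def)

lemma qform_zero_matrix [simp]: "qform 0 x = 0"
  by (simp add: qform_def)

lemma qform_add_matrix: "qform (M + N) x = qform M x + qform N x"
  by (simp add: qform_def matrix_vector_mult_add_rdistrib inner_add_right)

lemma qform_diff_matrix: "qform (M - N) x = qform M x - qform N x"
  by (simp add: qform_def matrix_vector_mult_diff_rdistrib inner_diff_right)

lemma qform_scaleR_matrix: "qform (c *\<^sub>R M) x = c * qform M x"
  by (simp add: qform_def scaleR_matrix_vector_assoc[symmetric])

lemma qform_sum_matrix: "qform (\<Sum>i\<in>I. M i) x = (\<Sum>i\<in>I. qform (M i) x)"
  by (induction I rule: infinite_finite_induct) (auto simp: qform_add_matrix)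

lemma qform_mat_1: "qform (mat 1) x = (norm x)\<^sup>2"
  by (simp add: qform_def power2_norm_eq_inner)

lemma qform_scaleR: "qform M (c *\<^sub>R x) = c\<^sup>2 * qform M x"
  by (simp add: qform_def matrix_vector_mult_scaleR power2_eq_square)

lemma inner_symmetric_mult_commute:
  "transpose M = M \<Longrightarrow> x \<bullet> (M *v y) = y \<bullet> (M *v x)" for M :: "real ^ 'n ^ 'n"
  by (metis inner_symmetric_mult inner_commute)

lemma qform_add:
  assumes "transpose M = M"
  shows "qform M (x + y) = qform M x + 2 * (x \<bullet> (M *v y)) + qform M y"
  using inner_symmetric_mult_commute[OF assms, of x y]
  by (simp add: qform_def matrix_vector_right_distrib inner_add_left inner_add_right)

lemma qform_conj: "qform (transpose N ** M ** N) x = qform M (N *v x)"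
  for M :: "real ^ 'n ^ 'n" and N :: "real ^ 'm ^ 'n"
  by (simp add: qform_def matrix_vector_mul_assoc[symmetric] inner_transpose_mult
      del: transpose_matrix_vector)

lemma transpose_add: "transpose (M + N) = transpose M + transpose N"
  by (simp add: transpose_def vec_eq_iff)

lemma transpose_scaleR: "transpose (c *\<^sub>R M) = c *\<^sub>R transpose M"
  by (simp add: transpose_def vec_eq_iff)

lemma transpose_sum: "transpose (\<Sum>i\<in>I. M i) = (\<Sum>i\<in>I. transpose (M i))"
  by (simp add: transpose_def vec_eq_iff)

lemma transpose_conj:
  "transpose M = M \<Longrightarrow> transpose (transpose N ** M ** N) = transpose N ** M ** N"
  for M :: "real ^ 'n ^ 'n" and N :: "real ^ 'm ^ 'n"
  by (simp add: matrix_transpose_mul matrix_mul_assoc)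

lemma pos_def_iff_qform:
  "pos_def M \<longleftrightarrow> transpose M = M \<and> (\<forall>x. x \<noteq> 0 \<longrightarrow> 0 < qform M x)"
  by (simp add: pos_def_def qform_def)

lemma pos_def_symmetric: "pos_def M \<Longrightarrow> transpose M = M"
  by (simp add: pos_def_def)

lemma pos_def_imp_pos_semidef: "pos_def M \<Longrightarrow> pos_semidef M"
  unfolding pos_def_iff_qform pos_semidef_def by (metis less_eq_real_def qform_0)

lemma pos_semidef_symmetric: "pos_semidef M \<Longrightarrow> transpose M = M"
  by (simp add: pos_semidef_def)

lemma pos_semidef_nonneg: "pos_semidef M \<Longrightarrow> 0 \<le> qform M x"
  by (simp add: pos_semidef_def)

lemma pos_semidef_conj:
  "pos_semidef M \<Longrightarrow> pos_semidef (transpose N ** M ** N)"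
  by (simp add: pos_semidef_def transpose_conj qform_conj)

lemma pos_semidef_add: "pos_semidef M \<Longrightarrow> pos_semidef N \<Longrightarrow> pos_semidef (M + N)"
  by (simp add: pos_semidef_def transpose_add qform_add_matrix)

lemma pos_def_add_pos_semidef: "pos_def M \<Longrightarrow> pos_semidef N \<Longrightarrow> pos_def (M + N)"
  by (auto simp: pos_semidef_def pos_def_iff_qform transpose_add qform_add_matrix add_pos_nonneg)

lemma pos_semidef_mat_1: "pos_semidef (mat 1)"
  by (simp add: pos_semidef_def qform_mat_1)

lemma continuous_on_qform [continuous_intros]: "continuous_on S (qform M)"
  unfolding qform_def
  by (intro continuous_intros linear_continuous_on matrix_vector_mul_bounded_linear)

lemma qform_bounded:
  obtains c where "0 \<le> c" and "\<And>x. \<bar>qform M x\<bar> \<le> c * (norm x)\<^sup>2"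
proof -
  obtain K where K: "norm (M *v x) \<le> norm x * K" and "0 < K" for x
    using bounded_linear.pos_bounded[OF matrix_vector_mul_bounded_linear[of M]] by blast
  have "\<bar>qform M x\<bar> \<le> K * (norm x)\<^sup>2" for x
  proof -
    have "\<bar>qform M x\<bar> \<le> norm x * norm (M *v x)"
      unfolding qform_def by (rule Cauchy_Schwarz_ineq2)
    also have "\<dots> \<le> norm x * (norm x * K)"
      by (intro mult_left_mono K) auto
    finally show ?thesis by (simp add: power2_eq_square mult_ac)
  qed
  with \<open>0 < K\<close> show ?thesis using that[of K] by simp
qed

text \<open>The continuous form has a positive minimum on the compact unit sphere, and homogeneity
  of degree two extends the bound to all vectors.\<close>

lemma pos_def_lower_bound:
  fixes M :: "real ^ 'n ^ 'n"
  assumes "pos_def M"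
  obtains c where "0 < c" and "\<And>x. c * (norm x)\<^sup>2 \<le> qform M x"
proof -
  let ?S = "sphere (0 :: real ^ 'n) 1"
  have "?S \<noteq> {}" by simp
  then obtain x0 where x0: "x0 \<in> ?S" "\<And>y. y \<in> ?S \<Longrightarrow> qform M x0 \<le> qform M y"
    using continuous_attains_inf[OF compact_sphere _ continuous_on_qform, of 0 1 M] by blast
  have pos: "0 < qform M x0"
    using x0(1) assms unfolding pos_def_iff_qform by (metis dist_0_norm mem_sphere norm_zero zero_neq_one)
  have "qform M x0 * (norm x)\<^sup>2 \<le> qform M x" for x
  proof (cases "x = 0")
    case False
    define y where "y = (1 / norm x) *\<^sub>R x"
    have "y \<in> ?S" using False by (simp add: y_def)
    then have "(norm x)\<^sup>2 * qform M x0 \<le> (norm x)\<^sup>2 * qform M y"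
      using x0(2) by (intro mult_left_mono) auto
    also have "\<dots> = qform M (norm x *\<^sub>R y)" by (simp add: qform_scaleR)
    also have "norm x *\<^sub>R y = x" using False by (simp add: y_def)
    finally show ?thesis by (simp add: mult.commute)
  qed simp
  with pos show ?thesis using that by blast
qed

lemma pos_def_invertible:
  fixes M :: "real ^ 'n ^ 'n"
  assumes "pos_def M"
  shows "invertible M"
proof -
  have "M *v x = 0 \<Longrightarrow> x = 0" for x
    using assms unfolding pos_def_def by force
  then show ?thesis
    by (simp add: invertible_left_inverse matrix_left_invertible_ker)
qed

lemma matrix_inv_mult_vector:
  fixes M :: "real ^ 'n ^ 'n"
  assumes "invertible M"
  shows "M *v (matrix_inv M *v x) = x"
proof -
  have "M ** matrix_inv M = mat 1"
    using someI_ex[OF assms[unfolded invertible_def]] by (simp add: matrix_inv_def)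
  then show ?thesis
    by (simp add: matrix_vector_mul_assoc)
qed

text \<open>Finitely many values of the form determine a symmetric matrix, so convergence of the
  forms at each vector becomes convergence of the entries.\<close>

lemma matrix_entry_polarization:
  fixes M :: "real ^ 'n ^ 'n"
  assumes "transpose M = M"
  shows "M $ i $ j =
    (qform M (axis i 1 + axis j 1) - qform M (axis i 1) - qform M (axis j 1)) / 2"
proof -
  have "axis i 1 \<bullet> (M *v axis j 1) = M $ i $ j"
    by (simp add: matrix_vector_mult_basis column_def inner_axis')
  then show ?thesis
    using assms by (simp add: qform_add)
qed

lemma symmetric_eqI:
  assumes "transpose M = M" "transpose N = N" "\<And>x. qform M x = qform N x"
  shows "M = N"
  unfolding vec_eq_iff matrix_entry_polarization[OF assms(1)] matrix_entry_polarization[OF assms(2)]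
    assms(3) by simp

lemma qform_expand: "qform M x = (\<Sum>i\<in>UNIV. \<Sum>j\<in>UNIV. x $ i * M $ i $ j * x $ j)"
  by (simp add: qform_def inner_vec_def matrix_vector_mult_def sum_distrib_left mult_ac)

lemma symmetric_matrix_seq_convergent:
  fixes M :: "nat \<Rightarrow> real ^ 'n ^ 'n"
  assumes sym: "\<And>k. transpose (M k) = M k"
    and conv: "\<And>x. convergent (\<lambda>k. qform (M k) x)"
  obtains P where "transpose P = P" and "\<And>x. (\<lambda>k. qform (M k) x) \<longlonglongrightarrow> qform P x"
proof -
  have "convergent (\<lambda>k. M k $ i $ j)" for i j
    unfolding matrix_entry_polarization[OF sym]
    unfolding divide_inverse by (intro convergent_diff convergent_mult conv convergent_const)
  then have lim: "(\<lambda>k. M k $ i $ j) \<longlonglongrightarrow> lim (\<lambda>k. M k $ i $ j)" for i j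
    by (simp add: convergent_LIMSEQ_iff)
  define P :: "real ^ 'n ^ 'n" where "P = (\<chi> i j. lim (\<lambda>k. M k $ i $ j))"
  have "M k $ j $ i = M k $ i $ j" for k i j
    using sym[of k] by (metis transpose_def vec_lambda_beta)
  then have "transpose P = P"
    by (simp add: P_def transpose_def vec_eq_iff)
  moreover have "(\<lambda>k. qform (M k) x) \<longlonglongrightarrow> qform P x" for x
    unfolding qform_expand P_def vec_lambda_beta by (intro tendsto_intros lim)
  ultimately show ?thesis using that by blast
qed

text \<open>Upgrades pointwise convergence to a bound uniform over directions: the sum of the
  absolute entries dominates the form on unit vectors, and each of the finitely many entries tends
  to zero.\<close>

lemma symmetric_matrix_seq_small:
  fixes M :: "nat \<Rightarrow> real ^ 'n ^ 'n"
  assumes sym: "\<And>k. transpose (M k) = M k"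
    and lim: "\<And>x. (\<lambda>k. qform (M k) x) \<longlonglongrightarrow> 0" and "0 < e"
  obtains m where "\<And>x. qform (M m) x \<le> e * (norm x)\<^sup>2"
proof -
  have "(\<lambda>k. (qform (M k) (axis i 1 + axis j 1) - qform (M k) (axis i 1) - qform (M k) (axis j 1)) / 2)
      \<longlonglongrightarrow> (0 - 0 - 0) / 2" for i j
    by (intro tendsto_intros lim) simp
  then have "(\<lambda>k. M k $ i $ j) \<longlonglongrightarrow> 0" for i j
    unfolding matrix_entry_polarization[OF sym] by simp
  then have "(\<lambda>k. \<Sum>i\<in>UNIV. \<Sum>j\<in>UNIV. \<bar>M k $ i $ j\<bar>) \<longlonglongrightarrow> (\<Sum>i\<in>(UNIV::'n set). \<Sum>j\<in>(UNIV::'n set). \<bar>0\<bar>)"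
    by (intro tendsto_intros)
  then have "(\<lambda>k. \<Sum>i\<in>UNIV. \<Sum>j\<in>UNIV. \<bar>M k $ i $ j\<bar>) \<longlonglongrightarrow> 0"
    by simp
  from eventually_happens'[OF sequentially_bot order_tendstoD(2)[OF this \<open>0 < e\<close>]]
  obtain m where m: "(\<Sum>i\<in>UNIV. \<Sum>j\<in>UNIV. \<bar>M m $ i $ j\<bar>) < e"
    by blast
  have "qform (M m) x \<le> e * (norm x)\<^sup>2" for x
  proof -
    have "qform (M m) x \<le> (\<Sum>i\<in>UNIV. \<Sum>j\<in>UNIV. \<bar>M m $ i $ j\<bar> * (norm x)\<^sup>2)"
      unfolding qform_expand
    proof (intro sum_mono)
      fix i j
      have "x $ i * M m $ i $ j * x $ j \<le> \<bar>x $ i * M m $ i $ j * x $ j\<bar>"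
        by (rule abs_ge_self)
      also have "\<dots> = \<bar>M m $ i $ j\<bar> * (\<bar>x $ i\<bar> * \<bar>x $ j\<bar>)"
        by (simp only: abs_mult mult_ac)
      also have "\<dots> \<le> \<bar>M m $ i $ j\<bar> * (norm x)\<^sup>2"
        unfolding power2_eq_square
        by (intro mult_left_mono mult_mono component_le_norm_cart) auto
      finally show "x $ i * M m $ i $ j * x $ j \<le> \<bar>M m $ i $ j\<bar> * (norm x)\<^sup>2" .
    qed
    also have "\<dots> = (\<Sum>i\<in>UNIV. \<Sum>j\<in>UNIV. \<bar>M m $ i $ j\<bar>) * (norm x)\<^sup>2"
      by (simp add: sum_distrib_right)
    also have "\<dots> \<le> e * (norm x)\<^sup>2"
      using m by (intro mult_right_mono) auto
    finally show ?thesis .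
  qed
  then show ?thesis using that by blast
qed

lemma matpow_commute: "matpow A k ** A = A ** matpow A k"
  by (induction k) (simp_all add: matrix_mul_assoc[symmetric])

lemma matpow_transpose: "matpow (transpose A) k = transpose (matpow A k)"
  by (induction k) (simp_all add: matrix_transpose_mul matpow_commute[symmetric])


section \<open>The modified Riccati map as a minimal cost\<close>

locale riccati =
  fixes A :: "real ^ 'n ^ 'n" and B :: "real ^ 'm ^ 'n" and d :: nat
    and Q :: "real ^ 'n ^ 'n" and R :: "real ^ 'm ^ 'm"
  assumes pos_def_Q: "pos_def Q" and pos_def_R: "pos_def R"
begin

definition D :: "real ^ 'm ^ 'n" where
  "D = matpow A d ** B"

definition G :: "real ^ 'n ^ 'n \<Rightarrow> real ^ 'm ^ 'm" where
  "G P = R + transpose B ** P ** B + transpose D ** P ** D"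

text \<open>Up to sign, the feedback that minimises \<open>cost P\<close>.\<close>

definition gain :: "real ^ 'n ^ 'n \<Rightarrow> real ^ 'n ^ 'm" where
  "gain P = matrix_inv (G P) ** transpose B ** P ** A"

text \<open>The running cost plus the mean of \<open>qform P\<close> at
  \<open>A x + B u + \<nu> D u\<close> for centred \<open>\<nu>\<close> of unit variance; the cross
  term in \<open>\<nu>\<close> has averaged out.\<close>

definition cost :: "real ^ 'n ^ 'n \<Rightarrow> real ^ 'n \<Rightarrow> real ^ 'm \<Rightarrow> real" where
  "cost P x u = qform P (A *v x + B *v u) + qform P (D *v u) + qform Q x + qform R u"

lemma riccati_map_eq:
  "riccati_map A B d Q R g P =
     transpose A ** P ** A + Q - g *\<^sub>R (transpose A ** P ** B ** gain P)"
  by (simp add: riccati_map_def gain_def G_def D_def matpow_transpose matrix_transpose_mul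
      matrix_mul_assoc)

lemma pos_def_G: "pos_semidef P \<Longrightarrow> pos_def (G P)"
  unfolding G_def by (intro pos_def_add_pos_semidef pos_semidef_conj pos_def_R)

lemma qform_G: "qform (G P) u = qform R u + qform P (B *v u) + qform P (D *v u)"
  by (simp add: G_def qform_add_matrix qform_conj)

lemma G_gain:
  assumes "pos_semidef P"
  shows "G P *v (gain P *v x) = transpose B *v (P *v (A *v x))"
  unfolding gain_def matrix_vector_mul_assoc[symmetric]
  by (rule matrix_inv_mult_vector[OF pos_def_invertible[OF pos_def_G[OF assms]]])

lemma inner_gain:
  assumes "pos_semidef P"
  shows "(B *v u) \<bullet> (P *v (A *v x)) = u \<bullet> (G P *v (gain P *v x))"
  unfolding G_gain[OF assms] inner_transpose_mult ..

text \<open>The polarized form is computed because symmetry of the Riccati map is read off from it.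
  Writing the last term through \<open>G P\<close> makes it symmetric in \<open>x\<close> and
  \<open>y\<close> without any appeal to symmetry of the inverse.\<close>

lemma inner_riccati_map:
  assumes "pos_semidef P"
  shows "x \<bullet> (riccati_map A B d Q R g P *v y) =
    (A *v x) \<bullet> (P *v (A *v y)) + x \<bullet> (Q *v y) -
    g * ((gain P *v x) \<bullet> (G P *v (gain P *v y)))"
proof -
  have "x \<bullet> (riccati_map A B d Q R g P *v y) =
    (A *v x) \<bullet> (P *v (A *v y)) + x \<bullet> (Q *v y) - g * ((A *v x) \<bullet> (P *v (B *v (gain P *v y))))"
    unfolding riccati_map_eq
    by (simp add: matrix_vector_mult_diff_rdistrib matrix_vector_mult_add_rdistrib
        inner_diff_right inner_add_right scaleR_matrix_vector_assoc[symmetric]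
        matrix_vector_mul_assoc[symmetric] inner_transpose_mult del: transpose_matrix_vector)
  also have "(A *v x) \<bullet> (P *v (B *v (gain P *v y))) = (gain P *v y) \<bullet> (G P *v (gain P *v x))"
    unfolding inner_gain[OF assms, symmetric]
    by (rule inner_symmetric_mult_commute[OF pos_semidef_symmetric[OF assms]])
  also have "\<dots> = (gain P *v x) \<bullet> (G P *v (gain P *v y))"
    by (rule inner_symmetric_mult_commute[OF pos_def_symmetric[OF pos_def_G[OF assms]]])
  finally show ?thesis .
qed

lemma qform_riccati_map:
  assumes "pos_semidef P"
  shows "qform (riccati_map A B d Q R g P) x =
    qform P (A *v x) + qform Q x - g * qform (G P) (gain P *v x)"
  unfolding qform_def inner_riccati_map[OF assms] ..

lemma riccati_map_symmetric:
  assumes "pos_semidef P"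
  shows "transpose (riccati_map A B d Q R g P) = riccati_map A B d Q R g P"
proof (rule symmetric_matrixI)
  fix x y
  show "x \<bullet> (riccati_map A B d Q R g P *v y) = y \<bullet> (riccati_map A B d Q R g P *v x)"
    unfolding inner_riccati_map[OF assms]
      inner_symmetric_mult_commute[OF pos_semidef_symmetric[OF assms], of "A *v x"]
      inner_symmetric_mult_commute[OF pos_def_symmetric[OF pos_def_Q], of x]
      inner_symmetric_mult_commute[OF pos_def_symmetric[OF pos_def_G[OF assms]], of "gain P *v x"] ..
qed

text \<open>Completing the square in \<open>u\<close>, with \<open>G P\<close> as quadratic part and
  \<open>inner_gain\<close> for the cross term. Hence at \<open>g = 1\<close> the Riccati map is the
  minimum of \<open>cost P\<close> over the inputs, and the fixed point argument works with this
  minimum.\<close>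

lemma cost_eq_riccati_map:
  assumes "pos_semidef P"
  shows "cost P x u =
    qform (riccati_map A B d Q R 1 P) x + qform (G P) (u + gain P *v x)"
proof -
  have "qform P (A *v x + B *v u) =
      qform P (A *v x) + 2 * ((B *v u) \<bullet> (P *v (A *v x))) + qform P (B *v u)"
    using qform_add[OF pos_semidef_symmetric[OF assms], of "B *v u" "A *v x"]
    by (simp add: add.commute)
  then show ?thesis
    unfolding cost_def qform_riccati_map[OF assms]
      qform_add[OF pos_def_symmetric[OF pos_def_G[OF assms]]] inner_gain[OF assms]
    by (simp add: qform_G)
qed

lemma riccati_map_le_cost:
  assumes "pos_semidef P"
  shows "qform (riccati_map A B d Q R 1 P) x \<le> cost P x u"
  using cost_eq_riccati_map[OF assms, of x u] pos_def_G[OF assms]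
  by (simp add: pos_def_imp_pos_semidef pos_semidef_nonneg)

lemma riccati_map_eq_cost:
  assumes "pos_semidef P"
  shows "qform (riccati_map A B d Q R 1 P) x = cost P x (- (gain P *v x))"
  using cost_eq_riccati_map[OF assms] by simp

lemma cost_mono:
  assumes "\<And>x. qform P x \<le> qform P' x"
  shows "cost P x u \<le> cost P' x u"
  unfolding cost_def by (intro add_mono assms order_refl)

text \<open>A minimum of costs that are monotone in \<open>P\<close> is monotone in
  \<open>P\<close>: the minimiser for \<open>P'\<close> is an admissible input for
  \<open>P\<close>.\<close>

lemma riccati_map_mono:
  assumes "pos_semidef P" "pos_semidef P'" "\<And>x. qform P x \<le> qform P' x"
  shows "qform (riccati_map A B d Q R 1 P) x \<le> qform (riccati_map A B d Q R 1 P') x"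
  using riccati_map_le_cost[OF assms(1)] cost_mono[OF assms(3)] riccati_map_eq_cost[OF assms(2)]
  by (metis order_trans)

lemma qform_Q_le_cost:
  assumes "pos_semidef P"
  shows "qform Q x \<le> cost P x u"
  unfolding cost_def
  using pos_semidef_nonneg[OF assms] pos_semidef_nonneg[OF pos_def_imp_pos_semidef[OF pos_def_R]]
  by (simp add: add_nonneg_nonneg)

lemma qform_Q_le_riccati_map:
  "pos_semidef P \<Longrightarrow> qform Q x \<le> qform (riccati_map A B d Q R 1 P) x"
  by (simp add: riccati_map_eq_cost qform_Q_le_cost)

lemma pos_def_riccati_map: "pos_semidef P \<Longrightarrow> pos_def (riccati_map A B d Q R 1 P)"
  using qform_Q_le_riccati_map[of P] pos_def_Q riccati_map_symmetric[of P 1]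
  unfolding pos_def_iff_qform by (metis less_le_trans)

section \<open>Value iteration and fixed points at \<open>g = 1\<close>\<close>

definition value_iter :: "nat \<Rightarrow> real ^ 'n ^ 'n" where
  "value_iter k = (riccati_map A B d Q R 1 ^^ k) 0"

lemma value_iter_0: "value_iter 0 = 0"
  by (simp add: value_iter_def)

lemma value_iter_Suc: "value_iter (Suc k) = riccati_map A B d Q R 1 (value_iter k)"
  by (simp add: value_iter_def)

lemma pos_semidef_value_iter: "pos_semidef (value_iter k)"
proof (induction k)
  case 0
  show ?case by (simp add: value_iter_0 pos_semidef_def transpose_def vec_eq_iff)
next
  case (Suc k)
  then show ?case
    by (simp add: value_iter_Suc pos_def_imp_pos_semidef pos_def_riccati_map)
qed

lemma value_iter_mono: "qform (value_iter k) x \<le> qform (value_iter (Suc k)) x"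
proof (induction k arbitrary: x)
  case 0
  show ?case
    using pos_semidef_nonneg[OF pos_semidef_value_iter] by (simp add: value_iter_0)
next
  case (Suc k)
  show ?case
    using riccati_map_mono[OF pos_semidef_value_iter pos_semidef_value_iter Suc]
    by (simp only: value_iter_Suc)
qed

text \<open>
  The fixed point is the limit of value iteration. Continuity of the matrix inverse is not needed:
  the cost function is continuous in \<open>P\<close>, and the minimising inputs stay in a bounded set.
\<close>

lemma riccati_map_fixed_point:
  assumes S: "pos_semidef S" and super: "\<And>x. cost S x (K *v x) \<le> qform S x"
  obtains P where "pos_def P" and "P = riccati_map A B d Q R 1 P"
proof -
  have le_S: "qform (value_iter k) x \<le> qform S x" for k x
  proof (induction k arbitrary: x)
    case 0
    show ?case by (simp add: value_iter_0 pos_semidef_nonneg S)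
  next
    case (Suc k)
    \<comment> \<open>The feedback \<open>K\<close> may be suboptimal for
      \<open>value_iter k\<close>, so its cost bounds the minimum from above.\<close>
    have "qform (value_iter (Suc k)) x \<le> cost (value_iter k) x (K *v x)"
      unfolding value_iter_Suc by (intro riccati_map_le_cost pos_semidef_value_iter)
    also have "\<dots> \<le> cost S x (K *v x)"
      by (intro cost_mono Suc)
    finally show ?case using super by (rule order_trans)
  qed
  have inc: "incseq (\<lambda>k. qform (value_iter k) x)" for x
    by (intro incseq_SucI value_iter_mono)
  have "convergent (\<lambda>k. qform (value_iter k) x)" for x
    using incseq_convergent[OF inc le_S[THEN allI]] unfolding convergent_def by metis
  then obtain P where symP: "transpose P = P"
    and lim: "\<And>x. (\<lambda>k. qform (value_iter k) x) \<longlonglongrightarrow> qform P x"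
    using symmetric_matrix_seq_convergent[of value_iter, OF pos_semidef_symmetric[OF pos_semidef_value_iter]]
    by blast
  have le_P: "qform (value_iter k) x \<le> qform P x" for k x
    using incseq_le[OF inc lim] .
  have P: "pos_semidef P"
    unfolding pos_semidef_def using symP le_P[of 0] by (simp add: value_iter_0)
  let ?g = "riccati_map A B d Q R 1"
  have fix_q: "qform (?g P) x = qform P x" for x
  proof (rule antisym)
    have "qform (value_iter (Suc k)) x \<le> qform (?g P) x" for k
      unfolding value_iter_Suc by (intro riccati_map_mono pos_semidef_value_iter P le_P)
    then show "qform P x \<le> qform (?g P) x"
      by (intro LIMSEQ_le_const2[OF lim[THEN LIMSEQ_Suc]]) blast
  next
    define u where "u k = - (gain (value_iter k) *v x)" for k
    have cost_u: "cost (value_iter k) x (u k) = qform (value_iter (Suc k)) x" for k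
      unfolding u_def value_iter_Suc
      by (intro riccati_map_eq_cost[symmetric] pos_semidef_value_iter)
    obtain r where r: "0 < r" "\<And>v. r * (norm v)\<^sup>2 \<le> qform R v"
      using pos_def_lower_bound[OF pos_def_R] by blast
    \<comment> \<open>The minimal cost never exceeds \<open>qform S x\<close>, and its summand
      \<open>qform R u\<close> alone controls the norm of the input.\<close>
    define b where "b = sqrt (qform S x / r)"
    have u_le: "norm (u k) \<le> b" for k
    proof -
      have "r * (norm (u k))\<^sup>2 \<le> cost (value_iter k) x (u k)"
        unfolding cost_def using r(2)[of "u k"] pos_semidef_nonneg[OF pos_semidef_value_iter[of k]]
          pos_semidef_nonneg[OF pos_def_imp_pos_semidef[OF pos_def_Q]]
        by (smt (verit))
      also have "\<dots> \<le> qform S x" unfolding cost_u by (rule le_S)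
      finally show ?thesis
        using r(1) unfolding b_def by (intro real_le_rsqrt) (simp add: field_simps)
    qed
    define c where "c = (onorm ((*v) A) * norm x + onorm ((*v) B) * b)\<^sup>2 + (onorm ((*v) D) * b)\<^sup>2"
    have "qform (?g P) x \<le> qform P x"
    proof (rule field_le_epsilon)
      fix e :: real assume "0 < e"
      \<comment> \<open>Uniformity over directions is needed because the comparison takes place at
        vectors built from \<open>u m\<close>, which change with \<open>m\<close>.\<close>
      have "\<exists>m. \<forall>v. qform (P - value_iter m) v \<le> e / (c + 1) * (norm v)\<^sup>2"
      proof (rule symmetric_matrix_seq_small[of "\<lambda>k. P - value_iter k" "e / (c + 1)"])
        show "transpose (P - value_iter k) = P - value_iter k" for k
          using symP pos_semidef_symmetric[OF pos_semidef_value_iter[of k]]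
          by (simp add: transpose_def vec_eq_iff)
        show "(\<lambda>k. qform (P - value_iter k) v) \<longlonglongrightarrow> 0" for v
          unfolding qform_diff_matrix using tendsto_diff[OF tendsto_const lim, of "qform P v" v] by simp
        show "0 < e / (c + 1)"
          using \<open>0 < e\<close> unfolding c_def by (intro divide_pos_pos add_nonneg_pos) auto
      qed blast
      then obtain m where m: "\<And>v. qform (P - value_iter m) v \<le> e / (c + 1) * (norm v)\<^sup>2"
        by blast
      let ?w = "A *v x + B *v u m" and ?z = "D *v u m"
      have "norm ?w \<le> onorm ((*v) A) * norm x + onorm ((*v) B) * b"
        using norm_triangle_ineq[of "A *v x" "B *v u m"] onorm[OF matrix_vector_mul_bounded_linear, of A x]
          onorm[OF matrix_vector_mul_bounded_linear, of B "u m"]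
          mult_left_mono[OF u_le onorm_pos_le[OF matrix_vector_mul_bounded_linear], of B m]
        by linarith
      moreover have "norm ?z \<le> onorm ((*v) D) * b"
        using onorm[OF matrix_vector_mul_bounded_linear, of D "u m"]
          mult_left_mono[OF u_le onorm_pos_le[OF matrix_vector_mul_bounded_linear], of D m]
        by linarith
      ultimately have le_c: "(norm ?w)\<^sup>2 + (norm ?z)\<^sup>2 \<le> c"
        unfolding c_def by (intro add_mono power_mono) auto
      have c0: "0 \<le> c" unfolding c_def by simp
      \<comment> \<open>\<open>u m\<close> is optimal for \<open>value_iter m\<close> and merely
        admissible for \<open>P\<close>; exchanging the two matrices alters only the cost terms at
        \<open>?w\<close> and \<open>?z\<close>.\<close>
      have "qform (?g P) x \<le> cost P x (u m)"
        by (rule riccati_map_le_cost[OF P])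
      also have "\<dots> = cost (value_iter m) x (u m) + (qform (P - value_iter m) ?w + qform (P - value_iter m) ?z)"
        by (simp add: cost_def qform_diff_matrix)
      also have "\<dots> \<le> qform P x + (e / (c + 1) * (norm ?w)\<^sup>2 + e / (c + 1) * (norm ?z)\<^sup>2)"
        unfolding cost_u by (intro add_mono m le_P)
      also have "e / (c + 1) * (norm ?w)\<^sup>2 + e / (c + 1) * (norm ?z)\<^sup>2 \<le> e / (c + 1) * (c + 1)"
        unfolding distrib_left[symmetric] using le_c c0 \<open>0 < e\<close> by (intro mult_left_mono) auto
      also have "e / (c + 1) * (c + 1) = e" using c0 by simp
      finally show "qform (?g P) x \<le> qform P x + e" by simp
    qed
    then show "qform (?g P) x \<le> qform P x" .
  qed
  have eq: "P = ?g P"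
    by (rule symmetric_eqI[OF symP riccati_map_symmetric[OF P] fix_q[symmetric]])
  have "pos_def P"
    using pos_def_riccati_map[OF P] unfolding eq[symmetric] .
  then show ?thesis using eq by (rule that)
qed

text \<open>
  \<open>second_moment K\<close> is the adjoint of the evolution of the second moment of the closed loop
  with noise variance 1.
\<close>

definition second_moment :: "real ^ 'n ^ 'm \<Rightarrow> real ^ 'n ^ 'n \<Rightarrow> real ^ 'n ^ 'n" where
  "second_moment K X =
     transpose (A + B ** K) ** X ** (A + B ** K) + transpose (D ** K) ** X ** (D ** K)"

lemma qform_second_moment:
  "qform (second_moment K X) x = qform X (A *v x + B *v (K *v x)) + qform X (D *v (K *v x))"
  by (simp add: second_moment_def qform_add_matrix qform_conj matrix_vector_mult_add_rdistrib
      matrix_vector_mul_assoc)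

lemma pos_semidef_second_moment:
  "pos_semidef X \<Longrightarrow> pos_semidef (second_moment K X)"
  unfolding second_moment_def by (intro pos_semidef_add pos_semidef_conj)

lemma pos_semidef_second_moment_iter: "pos_semidef ((second_moment K ^^ k) (mat 1))"
  by (induction k) (simp_all add: pos_semidef_mat_1 pos_semidef_second_moment)

text \<open>A truncated Lyapunov sum suffices. Once the \<open>m\<close>-th iterate is at most half
  the squared norm, shifting the sum of the first \<open>m\<close> iterates by one step lowers it by
  at least half the squared norm, and this drop pays for the running cost.\<close>

lemma riccati_map_fixed_point_if_stable:
  assumes lim: "\<And>x. (\<lambda>k. qform ((second_moment K ^^ k) (mat 1)) x) \<longlonglongrightarrow> 0"
  obtains P where "pos_def P" and "P = riccati_map A B d Q R 1 P"
proof -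
  let ?Y = "\<lambda>k. (second_moment K ^^ k) (mat 1)"
  obtain m where m: "\<And>x. qform (?Y m) x \<le> 1 / 2 * (norm x)\<^sup>2"
    using symmetric_matrix_seq_small[of ?Y "1 / 2",
        OF pos_semidef_symmetric[OF pos_semidef_second_moment_iter] lim]
    by auto
  define W where "W = Q + transpose K ** R ** K"
  obtain c where c: "0 \<le> c" "\<And>x. \<bar>qform W x\<bar> \<le> c * (norm x)\<^sup>2"
    using qform_bounded by blast
  \<comment> \<open>The factor \<open>2 * c\<close> turns the drop of half the squared norm into
    \<open>c\<close> times the squared norm, the bound on \<open>qform W\<close>.\<close>
  define S where "S = (2 * c) *\<^sub>R (\<Sum>j<m. ?Y j)"
  have "pos_semidef S"
    unfolding S_def pos_semidef_def
    using c(1) pos_semidef_symmetric[OF pos_semidef_second_moment_iter]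
      pos_semidef_nonneg[OF pos_semidef_second_moment_iter]
    by (simp add: transpose_scaleR transpose_sum qform_scaleR_matrix qform_sum_matrix sum_nonneg)
  moreover have "cost S x (K *v x) \<le> qform S x" for x
  proof -
    have "cost S x (K *v x) = qform (second_moment K S) x + qform W x"
      by (simp add: cost_def qform_second_moment W_def qform_add_matrix qform_conj)
    also have "qform (second_moment K S) x = 2 * c * (\<Sum>j<m. qform (?Y (Suc j)) x)"
      unfolding S_def qform_second_moment
      by (simp add: qform_scaleR_matrix qform_sum_matrix qform_second_moment sum.distrib distrib_left)
    also have "(\<Sum>j<m. qform (?Y (Suc j)) x) = (\<Sum>j<m. qform (?Y j) x) + (qform (?Y m) x - (norm x)\<^sup>2)"
      using sum_lessThan_telescope[of "\<lambda>j. qform (?Y j) x" m]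
      by (simp add: sum_subtractf qform_mat_1 del: funpow.simps)
    finally have "cost S x (K *v x) = qform S x + 2 * c * (qform (?Y m) x - (norm x)\<^sup>2) + qform W x"
      by (simp add: S_def qform_scaleR_matrix qform_sum_matrix distrib_left)
    moreover have "2 * c * (qform (?Y m) x - (norm x)\<^sup>2) \<le> 2 * c * (- (1 / 2) * (norm x)\<^sup>2)"
      using m[of x] c(1) by (intro mult_left_mono) auto
    moreover have "qform W x \<le> c * (norm x)\<^sup>2"
      using c(2)[of x] by linarith
    ultimately show ?thesis by simp
  qed
  ultimately show ?thesis
    using riccati_map_fixed_point that by blast
qed

text \<open>
  The gain \<open>\<kappa> G\<^sup>-\<^sup>1 B' P A\<close> makes \<open>P\<close> a Lyapunov matrix for the mode \<open>l\<close> of the Laplacian, as soon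
  as the quadratic \<open>2 \<mu> c - (\<mu>\<^sup>2 + s) c\<^sup>2\<close> in \<open>c = l \<kappa>\<close> is at least the Riccati parameter \<open>g\<close>.
\<close>

lemma mode_lyapunov:
  assumes P: "pos_semidef P" and fix_P: "P = riccati_map A B d Q R g P"
    and "0 \<le> s" and g: "g \<le> 2 * \<mu> * c - (\<mu>\<^sup>2 + s) * c\<^sup>2"
  shows "qform P (A *v x - (\<mu> * c) *\<^sub>R (B *v (gain P *v x)))
    + s * c\<^sup>2 * qform P (D *v (gain P *v x)) \<le> qform P x - qform Q x"
proof -
  define w where "w = gain P *v x"
  define q where "q = qform (G P) w"
  have nn: "0 \<le> qform P v" for v by (rule pos_semidef_nonneg[OF P])
  have q_eq: "qform P (B *v w) + qform P (D *v w) + qform R w = q"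
    unfolding q_def qform_G by simp
  have nR: "0 \<le> qform R w"
    by (rule pos_semidef_nonneg[OF pos_def_imp_pos_semidef[OF pos_def_R]])
  have q0: "0 \<le> q" using q_eq nn nR by (smt (verit))
  have "qform P (A *v x - (\<mu> * c) *\<^sub>R (B *v w)) =
      qform P (- (\<mu> * c) *\<^sub>R (B *v w) + A *v x)"
    by simp
  also have "\<dots> = (\<mu> * c)\<^sup>2 * qform P (B *v w) - 2 * (\<mu> * c) * ((B *v w) \<bullet> (P *v (A *v x))) + qform P (A *v x)"
    unfolding qform_add[OF pos_semidef_symmetric[OF P]] qform_scaleR by simp
  \<comment> \<open>By the choice of gain the cross term is \<open>q\<close>, the same quantity that
    the Riccati equation subtracts with weight \<open>g\<close>.\<close>
  also have "(B *v w) \<bullet> (P *v (A *v x)) = q"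
    unfolding inner_gain[OF P] q_def w_def qform_def ..
  finally have 1: "qform P (A *v x - (\<mu> * c) *\<^sub>R (B *v w)) =
      (\<mu> * c)\<^sup>2 * qform P (B *v w) - 2 * (\<mu> * c) * q + qform P (A *v x)" .
  have "qform P x = qform P (A *v x) + qform Q x - g * q"
    using qform_riccati_map[OF P, of g x] fix_P by (simp add: q_def w_def)
  \<comment> \<open>The coefficients of the \<open>B\<close> and \<open>D\<close> terms are raised
    to the common value \<open>(\<mu>\<^sup>2 + s) * c\<^sup>2\<close>, because \<open>q\<close>
    bounds the sum of the two terms.\<close>
  moreover have "(\<mu> * c)\<^sup>2 * qform P (B *v w) \<le> (\<mu>\<^sup>2 + s) * c\<^sup>2 * qform P (B *v w)"
    using nn \<open>0 \<le> s\<close> by (intro mult_right_mono) (auto simp: algebra_simps)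
  moreover have "s * c\<^sup>2 * qform P (D *v w) \<le> (\<mu>\<^sup>2 + s) * c\<^sup>2 * qform P (D *v w)"
    using nn \<open>0 \<le> s\<close> by (intro mult_right_mono) (auto simp: algebra_simps)
  moreover have "(\<mu>\<^sup>2 + s) * c\<^sup>2 * qform P (B *v w) + (\<mu>\<^sup>2 + s) * c\<^sup>2 * qform P (D *v w) \<le> (\<mu>\<^sup>2 + s) * c\<^sup>2 * q"
    unfolding distrib_left[symmetric] using q_eq nR \<open>0 \<le> s\<close> by (intro mult_left_mono) auto
  moreover have "g * q \<le> (2 * \<mu> * c - (\<mu>\<^sup>2 + s) * c\<^sup>2) * q"
    using g q0 by (rule mult_right_mono)
  ultimately show ?thesis
    unfolding w_def[symmetric] 1 by (simp add: algebra_simps)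
qed

end


section \<open>Square-integrable random vectors and independent noise\<close>

text \<open>The sigma-algebra generated by \<open>X 0, ..., X (n - 1)\<close>, encoded as a pullback
  from the product space so that independence of disjoint blocks of variables applies to it.\<close>

definition past :: "'a measure \<Rightarrow> (nat \<Rightarrow> 'a \<Rightarrow> real) \<Rightarrow> nat \<Rightarrow> 'a measure" where
  "past M X n = vimage_algebra (space M) (\<lambda>\<omega>. \<lambda>i\<in>{..<n}. X i \<omega>) (Pi\<^sub>M {..<n} (\<lambda>_. borel))"

lemma space_past [simp]: "space (past M X n) = space M"
  by (simp add: past_def)

lemma past_vector_measurable:
  "(\<lambda>\<omega>. \<lambda>i\<in>{..<n}. X i \<omega>) \<in> past M X n \<rightarrow>\<^sub>M Pi\<^sub>M {..<n} (\<lambda>_. borel)"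
  unfolding past_def by (rule measurable_vimage_algebra1) (auto simp: space_PiM)

lemma measurable_past_component:
  assumes "i < n"
  shows "X i \<in> borel_measurable (past M X n)"
  using measurable_compose[OF past_vector_measurable measurable_component_singleton[of i "{..<n}"]] assms
  by simp

text \<open>\<open>past M X n\<close> is the coarsest sigma-algebra on \<open>space M\<close> for
  which the first \<open>n\<close> variables are measurable, so the identity from \<open>N\<close>
  into it is measurable.\<close>

lemma measurable_into_past:
  assumes "space N = space M" and "\<And>i. i < n \<Longrightarrow> X i \<in> borel_measurable N"
    and "Y \<in> past M X n \<rightarrow>\<^sub>M L"
  shows "Y \<in> N \<rightarrow>\<^sub>M L"
proof -
  have "(\<lambda>\<omega>. \<omega>) \<in> N \<rightarrow>\<^sub>M past M X n"
    unfolding past_def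
    using assms(1,2) by (intro measurable_vimage_algebra2 measurable_restrict) auto
  then show ?thesis
    using measurable_compose[OF _ assms(3)] by blast
qed

lemma measurable_past_mono:
  assumes "Y \<in> past M X m \<rightarrow>\<^sub>M L" and "m \<le> n"
  shows "Y \<in> past M X n \<rightarrow>\<^sub>M L"
  using assms by (intro measurable_into_past[OF _ _ assms(1)] measurable_past_component) auto

definition square_integrable :: "'a measure \<Rightarrow> ('a \<Rightarrow> real ^ 'n) \<Rightarrow> bool" where
  "square_integrable M Y \<longleftrightarrow>
     Y \<in> borel_measurable M \<and> integrable M (\<lambda>\<omega>. (norm (Y \<omega>))\<^sup>2)"

lemma square_integrable_cong:
  "(\<And>\<omega>. \<omega> \<in> space M \<Longrightarrow> Y \<omega> = Z \<omega>) \<Longrightarrow> square_integrable M Y = square_integrable M Z"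
  unfolding square_integrable_def
  by (auto cong: measurable_cong Bochner_Integration.integrable_cong)

lemma borel_measurable_matrix_vector_mult [measurable]:
  "(*v) N \<in> borel_measurable borel" for N :: "real ^ 'n ^ 'm"
  by (rule borel_measurable_continuous_onI[OF linear_continuous_on[OF matrix_vector_mul_bounded_linear]])

lemma borel_measurable_qform [measurable]: "qform P \<in> borel_measurable borel"
  by (rule borel_measurable_continuous_onI[OF continuous_on_qform])

lemma norm_add_sq_le: "(norm (x + y))\<^sup>2 \<le> 2 * (norm x)\<^sup>2 + 2 * (norm y)\<^sup>2"
  for x y :: "'a :: real_inner"
proof -
  have "0 \<le> (norm (x - y))\<^sup>2" by simp
  then show ?thesis
    unfolding power2_norm_eq_inner by (simp add: inner_simps inner_commute)
qed

lemma square_integrable_const [simp]: "finite_measure M \<Longrightarrow> square_integrable M (\<lambda>\<omega>. c)"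
  by (simp add: square_integrable_def finite_measure.integrable_const)

lemma square_integrable_add:
  assumes "square_integrable M Y" "square_integrable M Z"
  shows "square_integrable M (\<lambda>\<omega>. Y \<omega> + Z \<omega>)"
proof -
  have [measurable]: "Y \<in> borel_measurable M" "Z \<in> borel_measurable M"
    using assms by (auto simp: square_integrable_def)
  have "integrable M (\<lambda>\<omega>. 2 * (norm (Y \<omega>))\<^sup>2 + 2 * (norm (Z \<omega>))\<^sup>2)"
    using assms by (auto simp: square_integrable_def)
  then have "integrable M (\<lambda>\<omega>. (norm (Y \<omega> + Z \<omega>))\<^sup>2)"
    by (rule Bochner_Integration.integrable_bound) (auto simp: norm_add_sq_le intro!: AE_I2)
  then show ?thesis by (simp add: square_integrable_def)
qed

lemma square_integrable_mult_vector:
  fixes N :: "real ^ 'n ^ 'm"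
  assumes "square_integrable M Y"
  shows "square_integrable M (\<lambda>\<omega>. N *v Y \<omega>)"
proof -
  have [measurable]: "Y \<in> borel_measurable M"
    using assms by (auto simp: square_integrable_def)
  have "integrable M (\<lambda>\<omega>. (onorm ((*v) N))\<^sup>2 * (norm (Y \<omega>))\<^sup>2)"
    using assms by (auto simp: square_integrable_def)
  then have "integrable M (\<lambda>\<omega>. (norm (N *v Y \<omega>))\<^sup>2)"
    by (rule Bochner_Integration.integrable_bound)
      (auto simp: power_mult_distrib[symmetric] intro!: AE_I2 power_mono onorm)
  then show ?thesis by (simp add: square_integrable_def)
qed

lemma square_integrable_scaleR:
  assumes "square_integrable M Y"
  shows "square_integrable M (\<lambda>\<omega>. c *\<^sub>R Y \<omega>)"
  using assms by (auto simp: square_integrable_def power_mult_distrib)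

lemma integrable_qform:
  assumes "square_integrable M Y"
  shows "integrable M (\<lambda>\<omega>. qform P (Y \<omega>))"
proof -
  have [measurable]: "Y \<in> borel_measurable M"
    using assms by (auto simp: square_integrable_def)
  obtain c where c: "0 \<le> c" "\<And>x. \<bar>qform P x\<bar> \<le> c * (norm x)\<^sup>2"
    using qform_bounded by blast
  have "integrable M (\<lambda>\<omega>. c * (norm (Y \<omega>))\<^sup>2)"
    using assms by (auto simp: square_integrable_def)
  then show ?thesis
    by (rule Bochner_Integration.integrable_bound) (use c in \<open>auto intro!: AE_I2\<close>)
qed

lemma integrable_inner_mult:
  assumes "square_integrable M Y" "square_integrable M Z"
  shows "integrable M (\<lambda>\<omega>. Y \<omega> \<bullet> (P *v Z \<omega>))"
proof -
  have YZ: "square_integrable M (\<lambda>\<omega>. Y \<omega> + P *v Z \<omega>)" "square_integrable M (\<lambda>\<omega>. P *v Z \<omega>)"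
    by (intro square_integrable_add square_integrable_mult_vector assms)+
  have eq: "Y \<omega> \<bullet> (P *v Z \<omega>) = (qform (mat 1) (Y \<omega> + P *v Z \<omega>) - qform (mat 1) (Y \<omega>)
      - qform (mat 1) (P *v Z \<omega>)) / 2" for \<omega>
    by (simp add: qform_add)
  show ?thesis
    unfolding eq
    by (intro integrable_divide Bochner_Integration.integrable_diff integrable_qform YZ assms)
qed


context prob_space
begin

text \<open>\<open>Z\<close> generates a subalgebra of the one generated by
  \<open>X 0, ..., X (n - 1)\<close>, and \<open>f (X n)\<close> a subalgebra of the one generated
  by \<open>X n\<close>; the two blocks of indices are disjoint.\<close>

lemma indep_var_past:
  fixes Z :: "'a \<Rightarrow> real" and f :: "real \<Rightarrow> real"
  assumes indep: "indep_vars (\<lambda>_. borel) X UNIV"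
    and Z: "Z \<in> borel_measurable (past M X n)" and f: "f \<in> borel_measurable borel"
  shows "indep_var borel Z borel (\<lambda>\<omega>. f (X n \<omega>))"
proof -
  let ?T = "\<lambda>I. Pi\<^sub>M I (\<lambda>_. borel :: real measure)" and ?V = "\<lambda>I \<omega>. \<lambda>i\<in>I. X i \<omega>"
  let ?A = "\<lambda>I. vimage_algebra (space M) (?V I) (?T I)"
  have X: "X i \<in> borel_measurable M" for i
    using indep by (auto simp: indep_vars_def)
  have sub: "sigma_sets (space M) {h -` S \<inter> space M |S. S \<in> sets borel} \<subseteq> sets (?A I)"
    if "h \<in> borel_measurable (?A I)" for I and h :: "'a \<Rightarrow> real"
  proof -
    have "{h -` S \<inter> space M |S. S \<in> sets borel} \<subseteq> sets (?A I)"
      using measurable_sets[OF that] by auto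
    from sets.sigma_sets_subset[OF this] show ?thesis by simp
  qed
  have V: "?V I \<in> ?A I \<rightarrow>\<^sub>M ?T I" for I
    by (rule measurable_vimage_algebra1) (auto simp: space_PiM)
  have "(\<lambda>x. x n) \<in> borel_measurable (?T {n})"
    by (rule measurable_component_singleton) simp
  from measurable_compose[OF V measurable_compose[OF this f]]
  have fX: "(\<lambda>\<omega>. f (X n \<omega>)) \<in> borel_measurable (?A {n})"
    by simp
  have "indep_var (?T {..<n}) (?V {..<n}) (?T {n}) (?V {n})"
    using indep by (rule indep_var_restrict) auto
  then have "indep_set (sets (?A {..<n})) (sets (?A {n}))"
    unfolding indep_var_eq sets_vimage_algebra by blast
  then have "indep_set (sigma_sets (space M) {Z -` S \<inter> space M |S. S \<in> sets borel})
      (sigma_sets (space M) {(\<lambda>\<omega>. f (X n \<omega>)) -` S \<inter> space M |S. S \<in> sets borel})"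
    unfolding indep_set_def
    by (rule indep_sets_mono_sets)
      (use sub[OF Z[unfolded past_def]] sub[OF fX] in \<open>auto split: bool.splits\<close>)
  moreover have "Z \<in> borel_measurable M"
    by (rule measurable_into_past[OF _ _ Z]) (auto simp: X)
  ultimately show ?thesis
    unfolding indep_var_eq using measurable_compose[OF X f] by blast
qed

text \<open>In the expansion of the form, the cross term has mean zero and the mean of the square
  factorises, since \<open>f (X n)\<close> is centred and independent of the past. The function
  \<open>f\<close> allows both the white noise itself and the deviation of a Bernoulli variable from
  its mean.\<close>

lemma noise_step:
  fixes U V :: "'a \<Rightarrow> real ^ 'n"
  assumes indep: "indep_vars (\<lambda>_. borel) X UNIV"
    and U: "U \<in> borel_measurable (past M X n)" "square_integrable M U"
    and V: "V \<in> borel_measurable (past M X n)" "square_integrable M V"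
    and f [measurable]: "f \<in> borel_measurable borel"
    and int2: "integrable M (\<lambda>\<omega>. (f (X n \<omega>))\<^sup>2)"
    and mean: "expectation (\<lambda>\<omega>. f (X n \<omega>)) = 0"
    and var: "expectation (\<lambda>\<omega>. (f (X n \<omega>))\<^sup>2) = s"
  shows "square_integrable M (\<lambda>\<omega>. U \<omega> + f (X n \<omega>) *\<^sub>R V \<omega>)"
    and "transpose P = P \<Longrightarrow> expectation (\<lambda>\<omega>. qform P (U \<omega> + f (X n \<omega>) *\<^sub>R V \<omega>)) =
      expectation (\<lambda>\<omega>. qform P (U \<omega>)) + s * expectation (\<lambda>\<omega>. qform P (V \<omega>))"
proof -
  have [measurable]: "X n \<in> borel_measurable M"
    using indep by (auto simp: indep_vars_def)
  have [measurable]: "U \<in> borel_measurable M" "V \<in> borel_measurable M"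
    using U V by (auto simp: square_integrable_def)
  have intf: "integrable M (\<lambda>\<omega>. f (X n \<omega>))"
    by (rule square_integrable_imp_integrable[OF _ int2]) simp
  note [measurable] = U(1) V(1)
  have ind1: "indep_var borel (\<lambda>\<omega>. U \<omega> \<bullet> (P *v V \<omega>)) borel (\<lambda>\<omega>. f (X n \<omega>))" for P
    by (rule indep_var_past[OF indep]) measurable
  have ind2: "indep_var borel (\<lambda>\<omega>. qform P (V \<omega>)) borel (\<lambda>\<omega>. (f (X n \<omega>))\<^sup>2)" for P
    by (rule indep_var_past[OF indep, where f = "\<lambda>x. (f x)\<^sup>2"]) measurable
  have int1: "integrable M (\<lambda>\<omega>. (U \<omega> \<bullet> (P *v V \<omega>)) * f (X n \<omega>))"
    and E1: "expectation (\<lambda>\<omega>. (U \<omega> \<bullet> (P *v V \<omega>)) * f (X n \<omega>)) = 0" for P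
    using indep_var_integrable[OF ind1 integrable_inner_mult[OF U(2) V(2)] intf]
      indep_var_lebesgue_integral[OF ind1 integrable_inner_mult[OF U(2) V(2)] intf] mean by auto
  have int2': "integrable M (\<lambda>\<omega>. qform P (V \<omega>) * (f (X n \<omega>))\<^sup>2)"
    and E2: "expectation (\<lambda>\<omega>. qform P (V \<omega>) * (f (X n \<omega>))\<^sup>2) = s * expectation (\<lambda>\<omega>. qform P (V \<omega>))" for P
    using indep_var_integrable[OF ind2 integrable_qform[OF V(2)] int2]
      indep_var_lebesgue_integral[OF ind2 integrable_qform[OF V(2)] int2] var by auto
  have split: "qform P (U \<omega> + f (X n \<omega>) *\<^sub>R V \<omega>) =
      qform P (U \<omega>) + 2 * ((U \<omega> \<bullet> (P *v V \<omega>)) * f (X n \<omega>)) + qform P (V \<omega>) * (f (X n \<omega>))\<^sup>2"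
    if "transpose P = P" for P \<omega>
    using that by (simp add: qform_add qform_scaleR matrix_vector_mult_scaleR)
  \<comment> \<open>The squared norm is the form of the identity, so the same expansion yields
    integrability.\<close>
  have "integrable M (\<lambda>\<omega>. qform (mat 1) (U \<omega> + f (X n \<omega>) *\<^sub>R V \<omega>))"
    unfolding split[OF transpose_mat] by (intro Bochner_Integration.integrable_add integrable_mult_right integrable_qform U int1 int2')
  then show "square_integrable M (\<lambda>\<omega>. U \<omega> + f (X n \<omega>) *\<^sub>R V \<omega>)"
    by (simp add: square_integrable_def qform_mat_1)
  show "expectation (\<lambda>\<omega>. qform P (U \<omega> + f (X n \<omega>) *\<^sub>R V \<omega>)) =
      expectation (\<lambda>\<omega>. qform P (U \<omega>)) + s * expectation (\<lambda>\<omega>. qform P (V \<omega>))"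
    if "transpose P = P"
    unfolding split[OF that]
    by (subst Bochner_Integration.integral_add Bochner_Integration.integral_add
        | intro Bochner_Integration.integrable_add integrable_mult_right integrable_qform U int1 int2')+
      (simp add: E1 E2)
qed

end

text \<open>From a deterministic \<open>x0\<close>, the mean of a form along the closed loop is the
  value at \<open>x0\<close> of an iterate of the adjoint \<open>second_moment K\<close>.
  Mean-square stability therefore says that the iterates of the identity vanish pointwise.\<close>

lemma (in riccati) stabilizable_imp_fixed_point:
  assumes noise: "white_noise N \<nu>" and stab: "ms_stabilizable N \<nu> A B 0 D"
  obtains P where "pos_def P" and "P = riccati_map A B d Q R 1 P"
proof -
  interpret N: prob_space N using noise by (simp add: white_noise_def)
  have indep: "N.indep_vars (\<lambda>_. borel) \<nu> UNIV"
    and mean: "(\<integral>\<omega>. \<nu> k \<omega> \<partial>N) = 0" and var: "(\<integral>\<omega>. (\<nu> k \<omega>)\<^sup>2 \<partial>N) = 1" for k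
    using noise by (auto simp: white_noise_def)
  \<comment> \<open>A non-integrable function would have integral 0, so the value 1 certifies
    integrability.\<close>
  have int2: "integrable N (\<lambda>\<omega>. (\<nu> k \<omega>)\<^sup>2)" for k
    using var[of k] not_integrable_integral_eq by fastforce
  obtain K where K: "\<And>x0 x.
      \<forall>\<omega>\<in>space N. x 0 \<omega> = x0 \<and> (\<forall>k. let u = K *v x k \<omega> in
        x (Suc k) \<omega> = A *v x k \<omega> + B *v u + \<nu> k \<omega> *\<^sub>R (0 *v x k \<omega> + D *v u)) \<Longrightarrow> ms_tendsto_zero N x"
    using stab unfolding ms_stabilizable_def by blast
  have "(\<lambda>k. qform ((second_moment K ^^ k) (mat 1)) x0) \<longlonglongrightarrow> 0" for x0
  proof -
    \<comment> \<open>Stabilizability speaks about all solutions of the recursion; one is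
      constructed to apply it to.\<close>
    define x where "x k \<omega> = rec_nat x0 (\<lambda>k v. A *v v + B *v (K *v v) + \<nu> k \<omega> *\<^sub>R (D *v (K *v v))) k"
      for k \<omega>
    have x0: "x 0 \<omega> = x0" and xS: "x (Suc k) \<omega> =
        A *v x k \<omega> + B *v (K *v x k \<omega>) + \<nu> k \<omega> *\<^sub>R (D *v (K *v x k \<omega>))" for k \<omega>
      by (simp_all add: x_def)
    have "ms_tendsto_zero N x"
      by (rule K[of x x0]) (simp add: x0 xS Let_def)
    have meas: "x k \<in> borel_measurable (past N \<nu> k)" for k
    proof (induction k)
      case 0
      show ?case by (simp add: x0)
    next
      case (Suc k)
      have [measurable]: "x k \<in> borel_measurable (past N \<nu> (Suc k))"
        by (rule measurable_past_mono[OF Suc]) simp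
      have [measurable]: "\<nu> k \<in> borel_measurable (past N \<nu> (Suc k))"
        by (rule measurable_past_component) simp
      show ?case unfolding xS by measurable
    qed
    have Um: "(\<lambda>\<omega>. A *v x k \<omega> + B *v (K *v x k \<omega>)) \<in> borel_measurable (past N \<nu> k)"
      and Vm: "(\<lambda>\<omega>. D *v (K *v x k \<omega>)) \<in> borel_measurable (past N \<nu> k)" for k
      using meas[of k] by measurable
    note step = N.noise_step[where f = "\<lambda>x. x" and s = 1, OF indep Um _ Vm _ _ int2 mean var]
    have sq: "square_integrable N (x k)" for k
    proof (induction k)
      case 0
      show ?case by (simp add: x0 N.finite_measure_axioms)
    next
      case (Suc k)
      show ?case
        unfolding xS
        by (rule step(1)[OF square_integrable_add[OF square_integrable_mult_vector
              square_integrable_mult_vector[OF square_integrable_mult_vector]]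
              square_integrable_mult_vector[OF square_integrable_mult_vector]
              measurable_ident_sets[OF refl]])
          (intro Suc)+
    qed
    \<comment> \<open>The form stays arbitrary: each step averages out the last noise variable and
      replaces \<open>X\<close> by \<open>second_moment K X\<close>.\<close>
    have E: "(\<integral>\<omega>. qform X (x k \<omega>) \<partial>N) = qform ((second_moment K ^^ k) X) x0"
      if "pos_semidef X" for k X
      using that
    proof (induction k arbitrary: X)
      case 0
      show ?case by (simp add: x0 N.prob_space)
    next
      case (Suc k)
      have "(\<integral>\<omega>. qform X (x (Suc k) \<omega>) \<partial>N) =
        (\<integral>\<omega>. qform X (A *v x k \<omega> + B *v (K *v x k \<omega>)) \<partial>N) + 1 * (\<integral>\<omega>. qform X (D *v (K *v x k \<omega>)) \<partial>N)"
        unfolding xS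
        by (rule step(2)[OF square_integrable_add[OF square_integrable_mult_vector
              square_integrable_mult_vector[OF square_integrable_mult_vector]]
              square_integrable_mult_vector[OF square_integrable_mult_vector]
              measurable_ident_sets[OF refl] pos_semidef_symmetric[OF Suc.prems]])
          (intro sq)+
      also have "\<dots> = (\<integral>\<omega>. qform (second_moment K X) (x k \<omega>) \<partial>N)"
        unfolding qform_second_moment mult_1
        by (intro Bochner_Integration.integral_add[symmetric] integrable_qform square_integrable_add
            square_integrable_mult_vector sq)
      also have "\<dots> = qform ((second_moment K ^^ k) (second_moment K X)) x0"
        by (intro Suc.IH pos_semidef_second_moment Suc.prems)
      finally show ?case by (simp add: funpow_swap1)
    qed
    have "(\<integral>\<^sup>+ \<omega>. ennreal ((norm (x k \<omega>))\<^sup>2) \<partial>N) = ennreal (qform ((second_moment K ^^ k) (mat 1)) x0)" for k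
      using sq[of k] E[OF pos_semidef_mat_1, of k]
      by (subst nn_integral_eq_integral) (auto simp: square_integrable_def qform_mat_1)
    then have "(\<lambda>k. ennreal (qform ((second_moment K ^^ k) (mat 1)) x0)) \<longlonglongrightarrow> ennreal 0"
      using \<open>ms_tendsto_zero N x\<close> by (simp add: ms_tendsto_zero_def)
    then show ?thesis
      by (subst (asm) tendsto_ennreal_iff)
        (auto intro!: always_eventually pos_semidef_nonneg pos_semidef_second_moment_iter)
  qed
  then show ?thesis
    using riccati_map_fixed_point_if_stable that by blast
qed


section \<open>Spectral theorem and the Laplacian\<close>

text \<open>The Rayleigh quotient is maximised over the unit vectors of \<open>W\<close>. At a
  maximiser \<open>x\<close> with value \<open>m\<close>, the form of \<open>m I - L\<close> is
  nonnegative on \<open>W\<close> and vanishes at \<open>x\<close>, which forces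
  \<open>(m I - L) x = 0\<close>.\<close>

lemma symmetric_invariant_eigenvector:
  fixes L :: "real ^ 'v ^ 'v"
  assumes sym: "transpose L = L" and W: "subspace W" "W \<noteq> {0}"
    and inv: "\<And>x. x \<in> W \<Longrightarrow> L *v x \<in> W"
  obtains x c where "x \<in> W" "norm x = 1" "L *v x = c *\<^sub>R x"
proof -
  let ?S = "sphere 0 1 \<inter> W"
  obtain w where w: "w \<in> W" "w \<noteq> 0"
    using W subspace_0 by blast
  then have "(1 / norm w) *\<^sub>R w \<in> ?S"
    using W(1) by (simp add: subspace_scale)
  then have "?S \<noteq> {}" by blast
  moreover have "compact ?S"
    using closed_subspace[OF W(1)] by (intro compact_Int_closed) auto
  ultimately obtain x where x: "x \<in> ?S" and x_max: "\<And>y. y \<in> ?S \<Longrightarrow> qform L y \<le> qform L x"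
    using continuous_attains_sup[of ?S "qform L", OF _ _ continuous_on_qform] by blast
  define m where "m = qform L x"
  define N where "N = m *\<^sub>R mat 1 - L"
  have N_mult: "N *v y = m *\<^sub>R y - L *v y" for y
    by (simp add: N_def matrix_vector_mult_diff_rdistrib scaleR_matrix_vector_assoc[symmetric])
  have symN: "transpose N = N"
    using sym by (simp add: N_def transpose_def vec_eq_iff mat_def)
  have N_nonneg: "0 \<le> qform N y" if "y \<in> W" for y
  proof (cases "y = 0")
    case False
    define z where "z = (1 / norm y) *\<^sub>R y"
    have "z \<in> ?S" using False that W(1) by (simp add: z_def subspace_scale)
    then have "0 \<le> qform N z"
      using x_max[of z] by (simp add: N_def qform_diff_matrix qform_scaleR_matrix qform_mat_1 m_def)
    then have "0 \<le> (norm y)\<^sup>2 * qform N z" by simp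
    also have "\<dots> = qform N (norm y *\<^sub>R z)" by (simp add: qform_scaleR)
    also have "norm y *\<^sub>R z = y" using False by (simp add: z_def)
    finally show ?thesis .
  qed simp
  define y where "y = N *v x"
  define a where "a = y \<bullet> y"
  define b where "b = qform N y"
  have xW: "x \<in> W" and x1: "norm x = 1" using x by auto
  have yW: "y \<in> W"
    unfolding y_def N_mult using W(1) inv xW by (simp add: subspace_diff subspace_scale)
  have b: "0 \<le> b" using N_nonneg[OF yW] by (simp add: b_def)
  have "qform N x = 0"
    using x1 by (simp add: N_def qform_diff_matrix qform_scaleR_matrix qform_mat_1 m_def)
  moreover have "x \<bullet> (N *v y) = a"
    using inner_symmetric_mult[OF symN, of x y] by (simp add: a_def y_def)
  moreover have "0 \<le> qform N (x + t *\<^sub>R y)" for t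
    using W(1) xW yW by (intro N_nonneg) (simp add: subspace_add subspace_scale)
  ultimately have "0 \<le> 2 * (t * a) + t\<^sup>2 * b" for t
    by (simp add: qform_add[OF symN] qform_scaleR matrix_vector_mult_scaleR b_def)
  \<comment> \<open>A nonnegative quadratic in \<open>t\<close> without constant term has no linear
    term. This value of \<open>t\<close> shows it, and the \<open>+ 1\<close> keeps the denominator
    positive when \<open>b = 0\<close>.\<close>
  from this[of "- a / (b + 1)"]
  have "0 \<le> 2 * (- a / (b + 1) * a) + (- a / (b + 1))\<^sup>2 * b" .
  also have "\<dots> = - (a\<^sup>2 * (b + 2)) / (b + 1)\<^sup>2"
  proof -
    define c where "c = b + 1"
    have "c \<noteq> 0" "b = c - 1" using b by (auto simp: c_def)
    from \<open>c \<noteq> 0\<close> show ?thesis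
      unfolding \<open>b = c - 1\<close> by (simp add: field_simps power2_eq_square)
  qed
  finally have "a\<^sup>2 * (b + 2) \<le> 0"
    using b by (simp add: divide_le_0_iff zero_le_divide_iff)
  then have "a = 0"
    using b by (simp add: mult_le_0_iff)
  then have "L *v x = m *\<^sub>R x"
    by (simp add: a_def y_def N_mult)
  with xW x1 show ?thesis by (rule that)
qed

text \<open>A largest orthonormal set of eigenvectors is a basis: its orthogonal complement is
  invariant under the symmetric \<open>L\<close>, so a nonzero complement would supply one more
  eigenvector.\<close>

lemma symmetric_orthonormal_eigenbasis:
  fixes L :: "real ^ 'v ^ 'v"
  assumes sym: "transpose L = L"
  obtains e :: "'v \<Rightarrow> real ^ 'v" and lam :: "'v \<Rightarrow> real"
  where "\<And>i j. e i \<bullet> e j = (if i = j then 1 else 0)" and "\<And>i. L *v e i = lam i *\<^sub>R e i"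
proof -
  define good where "good S \<longleftrightarrow> pairwise orthogonal S \<and>
    (\<forall>x\<in>S. norm x = 1 \<and> (\<exists>c. L *v x = c *\<^sub>R x))" for S :: "(real ^ 'v) set"
  have indep: "independent S" if "good S" for S
  proof (rule pairwise_orthogonal_independent)
    show "pairwise orthogonal S" "0 \<notin> S" using that by (auto simp: good_def)
  qed
  have card_le: "finite S \<and> card S \<le> CARD('v)" if "good S" for S
    using independent_bound[OF indep[OF that]] by simp
  have "good {}" by (simp add: good_def)
  have "\<exists>S. good S \<and> (\<forall>T. good T \<longrightarrow> card T \<le> card S)"
    by (rule ex_has_greatest_nat[of good "{}" card "Suc CARD('v)"])
      (use \<open>good {}\<close> card_le in \<open>auto simp: less_Suc_eq_le\<close>)
  then obtain S where S: "good S" and S_max: "\<And>T. good T \<Longrightarrow> card T \<le> card S"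
    by metis
  have "card S = CARD('v)"
  proof (rule ccontr)
    assume "card S \<noteq> CARD('v)"
    then have "dim S < DIM(real ^ 'v)"
      using card_le[OF S] by (simp add: dim_eq_card_independent[OF indep[OF S]])
    then obtain w where w: "w \<noteq> 0" "\<And>y. y \<in> span S \<Longrightarrow> orthogonal w y"
      using orthogonal_to_subspace_exists by blast
    define W where "W = {x. \<forall>y\<in>S. orthogonal y x}"
    have "subspace W"
      by (auto simp: W_def subspace_def orthogonal_def inner_add_right)
    moreover have "w \<in> W"
      using w(2) by (auto simp: W_def orthogonal_commute span_base)
    moreover have "L *v x \<in> W" if "x \<in> W" for x
      unfolding W_def
    proof safe
      fix y assume "y \<in> S"
      then obtain c where "L *v y = c *\<^sub>R y" using S by (auto simp: good_def)
      then show "orthogonal y (L *v x)"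
        using that \<open>y \<in> S\<close> by (auto simp: W_def orthogonal_def inner_symmetric_mult[OF sym])
    qed
    ultimately obtain x c where x: "x \<in> W" "norm x = 1" "L *v x = c *\<^sub>R x"
      using symmetric_invariant_eigenvector[OF sym, of W] w(1) by (metis singletonD)
    have "good (insert x S)"
      using S x by (auto simp: good_def pairwise_insert W_def orthogonal_commute)
    moreover have "x \<notin> S"
      using x(1,2) by (auto simp: W_def orthogonal_def norm_eq_1)
    ultimately show False
      using S_max[of "insert x S"] card_le[OF S] by simp
  qed
  then obtain e where e: "bij_betw e (UNIV :: 'v set) S"
    using card_le[OF S] by (metis finite_class.finite_UNIV finite_same_card_bij)
  have "\<exists>c. L *v e i = c *\<^sub>R e i" for i
    using S bij_betwE[OF e] by (auto simp: good_def)
  then obtain lam where "\<And>i. L *v e i = lam i *\<^sub>R e i" by metis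
  moreover have "e i \<bullet> e j = (if i = j then 1 else 0)" for i j
  proof (cases "i = j")
    case True
    then show ?thesis using S bij_betwE[OF e] by (simp add: good_def norm_eq_1)
  next
    case False
    then have "e i \<noteq> e j" using bij_betw_imp_inj_on[OF e] by (auto dest: injD)
    then have "orthogonal (e i) (e j)"
      using S bij_betwE[OF e] by (auto simp: good_def intro: pairwiseD)
    with False show ?thesis by (simp add: orthogonal_def)
  qed
  ultimately show ?thesis using that by blast
qed

lemma orthonormal_basis_matrix:
  fixes e :: "'v \<Rightarrow> real ^ 'v"
  assumes "\<And>i j. e i \<bullet> e j = (if i = j then 1 else 0)"
  shows "transpose (\<chi> i j. e j $ i) ** (\<chi> i j. e j $ i) = mat 1"
    and "(\<chi> i j. e j $ i) ** transpose (\<chi> i j. e j $ i) = mat 1"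
proof -
  show "transpose (\<chi> i j. e j $ i) ** (\<chi> i j. e j $ i) = mat 1"
    using assms by (simp add: matrix_matrix_mult_def transpose_def mat_def vec_eq_iff inner_vec_def)
  then show "(\<chi> i j. e j $ i) ** transpose (\<chi> i j. e j $ i) = mat 1"
    using matrix_left_right_inverse by blast
qed

text \<open>The rows of a square matrix with orthonormal columns are orthonormal too. This rebuilds
  a vector from its components.\<close>

lemma orthonormal_basis_complete:
  fixes e :: "'v \<Rightarrow> real ^ 'v"
  assumes "\<And>i j. e i \<bullet> e j = (if i = j then 1 else 0)"
  shows "(\<Sum>l\<in>UNIV. e l $ i * e l $ j) = (if i = j then 1 else 0)"
proof -
  have "((\<chi> i j. e j $ i) ** transpose (\<chi> i j. e j $ i)) $ i $ j = (mat 1 :: real ^ 'v ^ 'v) $ i $ j"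
    using orthonormal_basis_matrix(2)[OF assms] by simp
  then show ?thesis
    by (simp add: matrix_matrix_mult_def transpose_def mat_def)
qed

lemma const_poly_sum: "(\<Sum>i\<in>I. [:f i:]) = [:\<Sum>i\<in>I. f i:]"
  by (induction I rule: infinite_finite_induct) auto

lemma map_matrix_const_poly_mult:
  fixes M N :: "real ^ 'v ^ 'v"
  shows "map_matrix (\<lambda>x. [:x:]) M ** map_matrix (\<lambda>x. [:x:]) N = map_matrix (\<lambda>x. [:x:]) (M ** N)"
  by (simp add: matrix_matrix_mult_def map_matrix_def vec_eq_iff const_poly_sum mult.commute)

text \<open>Ties the root-based \<open>eigval\<close> to the eigenbasis, multiplicities included.
  The diagonalisation is carried out over polynomial matrices, where the nonzero determinant of the
  basis matrix cancels.\<close>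

lemma charpoly_eigenbasis:
  fixes L :: "real ^ 'v ^ 'v" and e :: "'v \<Rightarrow> real ^ 'v"
  assumes ortho: "\<And>i j. e i \<bullet> e j = (if i = j then 1 else 0)"
    and eig: "\<And>i. L *v e i = lam i *\<^sub>R e i"
  shows "charpoly L = (\<Prod>i\<in>UNIV. [:- lam i, 1:])"
proof -
  define E :: "real ^ 'v ^ 'v" where "E = (\<chi> i j. e j $ i)"
  let ?c = "map_matrix (\<lambda>x :: real. [:x:])"
  let ?C = "(\<chi> i j. (if i = j then [:0, 1:] else 0) - [:L $ i $ j:]) :: real poly ^ 'v ^ 'v"
  let ?D = "(\<chi> i j. if i = j then [:- lam i, 1:] else 0) :: real poly ^ 'v ^ 'v"
  have "?c (transpose E) ** ?c E = mat 1"
    unfolding map_matrix_const_poly_mult E_def orthonormal_basis_matrix(1)[OF ortho]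
    by (simp add: map_matrix_def mat_def vec_eq_iff)
  then have "det (?c (transpose E)) * det (?c E) = 1"
    by (metis det_I det_mul)
  then have det0: "det (?c E) \<noteq> 0" by auto
  have LE: "(\<Sum>k\<in>UNIV. L $ i $ k * e j $ k) = lam j * e j $ i" for i j
    using arg_cong[OF eig[of j], of "\<lambda>v. v $ i"] by (simp add: matrix_vector_mult_def)
  have CE: "?C ** ?c E = ?c E ** ?D"
  proof -
    have "(\<Sum>k\<in>UNIV. ((if i = k then [:0, 1:] else 0) - [:L $ i $ k:]) * [:e j $ k:]) =
        (\<Sum>k\<in>UNIV. (if i = k then [:0, 1:] * [:e j $ k:] else 0)) - (\<Sum>k\<in>UNIV. [:L $ i $ k * e j $ k:])"
      for i j
      unfolding sum_subtractf[symmetric] by (intro sum.cong refl) (simp add: left_diff_distrib)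
    also have "\<dots> i j = [:0, 1:] * [:e j $ i:] - [:lam j * e j $ i:]" for i j
      by (simp add: const_poly_sum LE)
    finally have 1: "(\<Sum>k\<in>UNIV. ((if i = k then [:0, 1:] else 0) - [:L $ i $ k:]) * [:e j $ k:]) =
      [:0, 1:] * [:e j $ i:] - [:lam j * e j $ i:]" for i j .
    have "(?C ** ?c E) $ i $ j = (?c E ** ?D) $ i $ j" for i j
    proof -
      have "(?C ** ?c E) $ i $ j = [:0, 1:] * [:e j $ i:] - [:lam j * e j $ i:]"
        unfolding 1[symmetric] by (simp only: matrix_matrix_mult_def vec_lambda_beta nth_map_matrix E_def)
      also have "\<dots> = (\<Sum>k\<in>UNIV. if k = j then [:e k $ i:] * [:- lam k, 1:] else 0)"
        by simp
      also have "\<dots> = (?c E ** ?D) $ i $ j"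
        unfolding matrix_matrix_mult_def vec_lambda_beta nth_map_matrix E_def
        by (intro sum.cong refl) simp
      finally show ?thesis .
    qed
    then show ?thesis by (simp add: vec_eq_iff)
  qed
  have "det ?C * det (?c E) = det (?c E) * det ?D"
    unfolding det_mul[symmetric] CE ..
  then have "det ?C = det ?D" using det0 by simp
  also have "det ?D = (\<Prod>i\<in>UNIV. [:- lam i, 1:])"
    by (subst det_diagonal) auto
  finally show ?thesis by (simp add: charpoly_def)
qed

lemma proots_charpoly_eigenbasis:
  fixes L :: "real ^ 'v ^ 'v" and e :: "'v \<Rightarrow> real ^ 'v"
  assumes ortho: "\<And>i j. e i \<bullet> e j = (if i = j then 1 else 0)"
    and eig: "\<And>i. L *v e i = lam i *\<^sub>R e i"
  shows "proots (charpoly L) = image_mset lam (mset_set UNIV)"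
proof -
  have "proots (\<Prod>i\<in>I. [:- lam i, 1:]) = image_mset lam (mset_set I)" if "finite I" for I :: "'v set"
    using that by (induction I) (auto simp: proots_mult simp del: mult_pCons_left)
  then show ?thesis by (simp add: charpoly_eigenbasis[OF assms])
qed

section \<open>The spectrum of a connected graph Laplacian\<close>

lemma laplacian_symmetric: "weighted_graph a \<Longrightarrow> transpose (laplacian a) = laplacian a"
  by (auto simp: weighted_graph_def laplacian_def transpose_def vec_eq_iff)

lemma laplacian_mult: "(laplacian a *v x) $ i = (\<Sum>j\<in>UNIV. a $ i $ j * (x $ i - x $ j))"
proof -
  have "(laplacian a *v x) $ i =
      (\<Sum>j\<in>UNIV. (if i = j then (\<Sum>l\<in>UNIV. a $ i $ l) * x $ j else 0) - a $ i $ j * x $ j)"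
    unfolding matrix_vector_mult_def laplacian_def
    by (auto simp: left_diff_distrib intro!: sum.cong)
  also have "\<dots> = (\<Sum>l\<in>UNIV. a $ i $ l) * x $ i - (\<Sum>j\<in>UNIV. a $ i $ j * x $ j)"
    by (simp add: sum_subtractf)
  finally show ?thesis
    by (simp add: sum_distrib_right right_diff_distrib sum_subtractf)
qed

text \<open>Adding the double sum to its copy with exchanged indices turns the products into
  squares; each edge is counted in both orientations, hence the factor 2.\<close>

lemma qform_laplacian:
  assumes "weighted_graph a"
  shows "2 * qform (laplacian a) x = (\<Sum>i\<in>UNIV. \<Sum>j\<in>UNIV. a $ i $ j * (x $ i - x $ j)\<^sup>2)"
proof -
  have sym: "a $ i $ j = a $ j $ i" for i j
    using assms unfolding weighted_graph_def by (metis transpose_def vec_lambda_beta)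
  have q: "qform (laplacian a) x = (\<Sum>i\<in>UNIV. \<Sum>j\<in>UNIV. a $ i $ j * (x $ i - x $ j) * x $ i)"
    by (simp add: qform_def inner_vec_def laplacian_mult sum_distrib_left mult_ac)
  have "qform (laplacian a) x = (\<Sum>j\<in>UNIV. \<Sum>i\<in>UNIV. a $ i $ j * (x $ i - x $ j) * x $ i)"
    unfolding q by (rule sum.swap)
  also have "\<dots> = (\<Sum>i\<in>UNIV. \<Sum>j\<in>UNIV. a $ i $ j * (x $ j - x $ i) * x $ j)"
    by (intro sum.cong refl) (simp add: sym)
  finally have "2 * qform (laplacian a) x = (\<Sum>i\<in>UNIV. \<Sum>j\<in>UNIV. a $ i $ j * (x $ i - x $ j) * x $ i)
      + (\<Sum>i\<in>UNIV. \<Sum>j\<in>UNIV. a $ i $ j * (x $ j - x $ i) * x $ j)"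
    using q by simp
  also have "\<dots> = (\<Sum>i\<in>UNIV. \<Sum>j\<in>UNIV. a $ i $ j * (x $ i - x $ j)\<^sup>2)"
    unfolding sum.distrib[symmetric]
    by (intro sum.cong refl) (simp add: algebra_simps power2_eq_square)
  finally show ?thesis .
qed

lemma qform_laplacian_nonneg: "weighted_graph a \<Longrightarrow> 0 \<le> qform (laplacian a) x"
proof -
  assume a: "weighted_graph a"
  have "0 \<le> (\<Sum>i\<in>UNIV. \<Sum>j\<in>UNIV. a $ i $ j * (x $ i - x $ j)\<^sup>2)"
    using a by (intro sum_nonneg) (auto simp: weighted_graph_def)
  then show ?thesis using qform_laplacian[OF a, of x] by simp
qed

text \<open>A vanishing sum of nonnegative edge terms makes \<open>x\<close> agree across every
  edge, hence along every path.\<close>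

lemma laplacian_kernel_constant:
  assumes a: "weighted_graph a" and con: "connected_graph a" and "qform (laplacian a) x = 0"
  shows "x $ i = x $ j"
proof -
  have nn: "0 \<le> a $ i $ j * (x $ i - x $ j)\<^sup>2" for i j
    using a by (auto simp: weighted_graph_def)
  have "(\<Sum>i\<in>UNIV. \<Sum>j\<in>UNIV. a $ i $ j * (x $ i - x $ j)\<^sup>2) = 0"
    using qform_laplacian[OF a, of x] assms(3) by simp
  then have zero: "a $ i $ j * (x $ i - x $ j)\<^sup>2 = 0" for i j
    using nn by (simp add: sum_nonneg_eq_0_iff sum_nonneg)
  have step: "x $ i = x $ j" if "j \<in> neighbours a i" for i j
    using that zero[of i j] by (simp add: neighbours_def)
  have "(i, j) \<in> {(i, j). j \<in> neighbours a i}\<^sup>*"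
    using con by (auto simp: connected_graph_def)
  then show ?thesis
    by (induction rule: rtrancl_induct) (auto dest: step)
qed

text \<open>Connectivity makes eigenvectors for the eigenvalue 0 constant, so exactly one basis
  vector, \<open>e i0\<close>, belongs to it. Deleting one 0 from the sorted spectrum leaves the
  disagreement modes, whose extreme values are \<open>eigval 2\<close> and
  \<open>eigval CARD('v)\<close>.\<close>

lemma laplacian_eigenbasis:
  fixes a :: "real ^ 'v ^ 'v"
  assumes card: "CARD('v) \<ge> 2" and a: "weighted_graph a" and con: "connected_graph a"
  obtains e :: "'v \<Rightarrow> real ^ 'v" and lam :: "'v \<Rightarrow> real" and i0 :: 'v
  where "\<And>i j. e i \<bullet> e j = (if i = j then 1 else 0)"
    and "\<And>i. laplacian a *v e i = lam i *\<^sub>R e i"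
    and "\<And>i j. e i0 $ i = e i0 $ j"
    and "0 < eigval 2 (laplacian a)"
    and "\<And>i. i \<noteq> i0 \<Longrightarrow> eigval 2 (laplacian a) \<le> lam i"
    and "\<And>i. i \<noteq> i0 \<Longrightarrow> lam i \<le> eigval CARD('v) (laplacian a)"
proof -
  obtain e :: "'v \<Rightarrow> real ^ 'v" and lam :: "'v \<Rightarrow> real"
    where ortho: "\<And>i j. e i \<bullet> e j = (if i = j then 1 else 0)"
    and eig: "\<And>i. laplacian a *v e i = lam i *\<^sub>R e i"
    using symmetric_orthonormal_eigenbasis[OF laplacian_symmetric[OF a]] by blast
  have q: "qform (laplacian a) (e i) = lam i" for i
    using ortho[of i i] by (simp add: qform_def eig)
  have nn: "0 \<le> lam i" for i
    using qform_laplacian_nonneg[OF a, of "e i"] by (simp add: q)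
  have const: "e i $ j = e i $ k" if "lam i = 0" for i j k
    using laplacian_kernel_constant[OF a con] that q by metis
  \<comment> \<open>Otherwise the all-ones vector, which lies in the kernel, would be orthogonal to
    the whole basis, against completeness.\<close>
  obtain i0 where i0: "lam i0 = 0"
  proof (rule ccontr)
    assume "\<not> thesis"
    then have "lam i \<noteq> 0" for i using that by blast
    moreover have "lam i * (e i \<bullet> 1) = 0" for i
    proof -
      have "laplacian a *v 1 = 0" by (simp add: vec_eq_iff laplacian_mult)
      then have "e i \<bullet> (laplacian a *v 1) = 0" by simp
      then show ?thesis
        by (simp add: inner_symmetric_mult[OF laplacian_symmetric[OF a]] eig)
    qed
    ultimately have "e i \<bullet> 1 = 0" for i by auto
    then have zero: "(\<Sum>k\<in>UNIV. e i $ k) = 0" for i by (simp add: inner_vec_def)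
    fix v :: 'v
    have "1 = (\<Sum>k\<in>UNIV. \<Sum>l\<in>UNIV. e l $ v * e l $ k)"
      by (simp add: orthonormal_basis_complete[OF ortho])
    also have "\<dots> = (\<Sum>l\<in>UNIV. \<Sum>k\<in>UNIV. e l $ v * e l $ k)"
      by (rule sum.swap)
    also have "\<dots> = 0"
      by (simp add: sum_distrib_left[symmetric] zero)
    finally show False by simp
  qed
  have pos: "0 < lam i" if "i \<noteq> i0" for i
  proof (rule ccontr)
    assume "\<not> 0 < lam i"
    then have "lam i = 0" using nn[of i] by simp
    \<comment> \<open>Two nonzero constant vectors cannot be orthogonal.\<close>
    define c c' where "c = e i $ i" and "c' = e i0 $ i"
    have c: "e i $ j = c" "e i0 $ j = c'" for j
      unfolding c_def c'_def using const[OF \<open>lam i = 0\<close>] const[OF i0] by blast+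
    have "e i \<bullet> e i0 = real CARD('v) * (c * c')" "e i \<bullet> e i = real CARD('v) * (c * c)"
      "e i0 \<bullet> e i0 = real CARD('v) * (c' * c')"
      by (simp_all add: inner_vec_def c)
    then show False using ortho[of i i0] ortho[of i i] ortho[of i0 i0] that by auto
  qed
  define ys where "ys = sorted_list_of_multiset (image_mset lam (mset_set (UNIV - {i0})))"
  have "mset_set (UNIV :: 'v set) = add_mset i0 (mset_set (UNIV - {i0}))"
    by (metis finite_class.finite_UNIV UNIV_I mset_set.remove)
  then have "sorted_list_of_multiset (proots (charpoly (laplacian a))) = insort 0 ys"
    by (simp add: proots_charpoly_eigenbasis[OF ortho eig] ys_def i0)
  also have "\<dots> = 0 # ys"
    by (rule insort_is_Cons) (auto simp: ys_def nn)
  finally have ev: "eigval k (laplacian a) = (0 # ys) ! (k - 1)" for k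
    by (simp add: eigval_def)
  have set_ys: "set ys = lam ` (UNIV - {i0})"
    by (simp add: ys_def)
  have "length ys = size (image_mset lam (mset_set (UNIV - {i0})))"
    by (metis ys_def mset_sorted_list_of_multiset size_mset)
  then have len: "length ys = CARD('v) - 1" by simp
  have srt: "sorted ys" by (simp add: ys_def sorted_sorted_list_of_multiset)
  \<comment> \<open>Position \<open>k - 1\<close> of \<open>0 # ys\<close> is position
    \<open>k - 2\<close> of \<open>ys\<close> as soon as \<open>k\<close> is at least 2.\<close>
  have ev2: "eigval 2 (laplacian a) = ys ! 0" by (simp add: ev)
  have evN: "eigval CARD('v) (laplacian a) = ys ! (CARD('v) - 2)"
    using card by (simp add: ev nth_Cons' numeral_2_eq_2)
  have "ys ! 0 \<in> set ys" using len card by (intro nth_mem) simp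
  then obtain i1 where "i1 \<noteq> i0" "ys ! 0 = lam i1" unfolding set_ys by blast
  then have "0 < eigval 2 (laplacian a)" unfolding ev2 using pos by metis
  moreover have "eigval 2 (laplacian a) \<le> lam i \<and> lam i \<le> eigval CARD('v) (laplacian a)" if "i \<noteq> i0" for i
  proof -
    have "lam i \<in> set ys" using that by (auto simp: set_ys)
    then obtain n where n: "n < length ys" "lam i = ys ! n" by (metis in_set_conv_nth)
    then show ?thesis
      unfolding ev2 evN using srt len by (auto intro!: sorted_nth_mono)
  qed
  ultimately show ?thesis using that[OF ortho eig const[OF i0]] by blast
qed


section \<open>Mean-square convergence\<close>

text \<open>Bochner version of \<open>ms_tendsto_zero\<close>. Square integrability is demanded at
  every time, so that the default value 0 of an undefined integral cannot imitate
  convergence.\<close>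

definition l2_null :: "'a measure \<Rightarrow> (nat \<Rightarrow> 'a \<Rightarrow> real ^ 'n) \<Rightarrow> bool" where
  "l2_null M Y \<longleftrightarrow> (\<forall>t. square_integrable M (Y t)) \<and>
     (\<lambda>t. \<integral>\<omega>. (norm (Y t \<omega>))\<^sup>2 \<partial>M) \<longlonglongrightarrow> 0"

lemma l2_null_measurable: "l2_null M Y \<Longrightarrow> Y t \<in> borel_measurable M"
  by (simp add: l2_null_def square_integrable_def)

lemma l2_null_imp_ms_tendsto_zero:
  assumes "l2_null M Y"
  shows "ms_tendsto_zero M Y"
proof -
  have "(\<integral>\<^sup>+ \<omega>. ennreal ((norm (Y t \<omega>))\<^sup>2) \<partial>M) = ennreal (\<integral>\<omega>. (norm (Y t \<omega>))\<^sup>2 \<partial>M)" for t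
    using assms by (intro nn_integral_eq_integral) (auto simp: l2_null_def square_integrable_def)
  moreover have "(\<lambda>t. ennreal (\<integral>\<omega>. (norm (Y t \<omega>))\<^sup>2 \<partial>M)) \<longlonglongrightarrow> ennreal 0"
    using assms by (intro tendsto_ennrealI) (auto simp: l2_null_def)
  ultimately show ?thesis by (simp add: ms_tendsto_zero_def)
qed

lemma l2_null_cong:
  assumes "\<And>t \<omega>. \<omega> \<in> space M \<Longrightarrow> Y t \<omega> = Z t \<omega>"
  shows "l2_null M Y = l2_null M Z"
proof -
  have "square_integrable M (Y t) = square_integrable M (Z t)" for t
    by (rule square_integrable_cong) (rule assms)
  moreover have "(\<integral>\<omega>. (norm (Y t \<omega>))\<^sup>2 \<partial>M) = (\<integral>\<omega>. (norm (Z t \<omega>))\<^sup>2 \<partial>M)" for t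
    by (rule Bochner_Integration.integral_cong) (simp_all add: assms)
  ultimately show ?thesis by (simp add: l2_null_def)
qed

text \<open>Common source of the closure properties under sums, matrices and bounded
  factors.\<close>

lemma l2_null_dominated:
  assumes meas: "\<And>t. Y t \<in> borel_measurable M" and int: "\<And>t. integrable M (g t)"
    and le: "\<And>t. AE \<omega> in M. (norm (Y t \<omega>))\<^sup>2 \<le> g t \<omega>"
    and lim: "(\<lambda>t. \<integral>\<omega>. g t \<omega> \<partial>M) \<longlonglongrightarrow> 0"
  shows "l2_null M Y"
proof -
  have sq: "integrable M (\<lambda>\<omega>. (norm (Y t \<omega>))\<^sup>2)" for t
  proof (rule Bochner_Integration.integrable_bound[OF int[of t]])
    show "(\<lambda>\<omega>. (norm (Y t \<omega>))\<^sup>2) \<in> borel_measurable M" using meas[of t] by measurable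
    show "AE \<omega> in M. norm ((norm (Y t \<omega>))\<^sup>2) \<le> norm (g t \<omega>)" using le[of t] by eventually_elim simp
  qed
  have "(\<lambda>t. \<integral>\<omega>. (norm (Y t \<omega>))\<^sup>2 \<partial>M) \<longlonglongrightarrow> 0"
  proof (rule tendsto_sandwich[OF _ _ tendsto_const lim])
    show "\<forall>\<^sub>F t in sequentially. 0 \<le> (\<integral>\<omega>. (norm (Y t \<omega>))\<^sup>2 \<partial>M)"
      by simp
    show "\<forall>\<^sub>F t in sequentially. (\<integral>\<omega>. (norm (Y t \<omega>))\<^sup>2 \<partial>M) \<le> (\<integral>\<omega>. g t \<omega> \<partial>M)"
      by (intro always_eventually allI integral_mono_AE sq int le)
  qed
  then show ?thesis
    using sq meas by (simp add: l2_null_def square_integrable_def)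
qed

lemma l2_null_add:
  assumes "l2_null M Y" "l2_null M Z"
  shows "l2_null M (\<lambda>t \<omega>. Y t \<omega> + Z t \<omega>)"
proof (rule l2_null_dominated)
  have sq: "integrable M (\<lambda>\<omega>. (norm (Y t \<omega>))\<^sup>2)" "integrable M (\<lambda>\<omega>. (norm (Z t \<omega>))\<^sup>2)" for t
    using assms by (auto simp: l2_null_def square_integrable_def)
  show "(\<lambda>\<omega>. Y t \<omega> + Z t \<omega>) \<in> borel_measurable M" for t
    using assms[THEN l2_null_measurable, of t] by (rule borel_measurable_add)
  show "integrable M (\<lambda>\<omega>. 2 * (norm (Y t \<omega>))\<^sup>2 + 2 * (norm (Z t \<omega>))\<^sup>2)" for t
    using sq by auto
  show "AE \<omega> in M. (norm (Y t \<omega> + Z t \<omega>))\<^sup>2 \<le> 2 * (norm (Y t \<omega>))\<^sup>2 + 2 * (norm (Z t \<omega>))\<^sup>2" for t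
    by (simp add: norm_add_sq_le)
  have "(\<lambda>t. 2 * (\<integral>\<omega>. (norm (Y t \<omega>))\<^sup>2 \<partial>M) + 2 * (\<integral>\<omega>. (norm (Z t \<omega>))\<^sup>2 \<partial>M)) \<longlonglongrightarrow> 2 * 0 + 2 * 0"
    using assms by (intro tendsto_intros) (auto simp: l2_null_def)
  then show "(\<lambda>t. \<integral>\<omega>. 2 * (norm (Y t \<omega>))\<^sup>2 + 2 * (norm (Z t \<omega>))\<^sup>2 \<partial>M) \<longlonglongrightarrow> 0"
    using sq by simp
qed

lemma l2_null_zero: "l2_null M (\<lambda>t \<omega>. 0)"
  by (simp add: l2_null_def square_integrable_def)

lemma l2_null_sum:
  assumes "\<And>i. i \<in> I \<Longrightarrow> l2_null M (Y i)"
  shows "l2_null M (\<lambda>t \<omega>. \<Sum>i\<in>I. Y i t \<omega>)"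
  using assms
  by (induction I rule: infinite_finite_induct) (simp_all add: l2_null_zero l2_null_add)

lemma l2_null_mult_vector:
  fixes N :: "real ^ 'n ^ 'm"
  assumes "l2_null M Y"
  shows "l2_null M (\<lambda>t \<omega>. N *v Y t \<omega>)"
proof (rule l2_null_dominated)
  let ?c = "(onorm ((*v) N))\<^sup>2"
  show "(\<lambda>\<omega>. N *v Y t \<omega>) \<in> borel_measurable M" for t
    using assms square_integrable_mult_vector by (auto simp: l2_null_def square_integrable_def)
  show "integrable M (\<lambda>\<omega>. ?c * (norm (Y t \<omega>))\<^sup>2)" for t
    using assms by (auto simp: l2_null_def square_integrable_def)
  show "AE \<omega> in M. (norm (N *v Y t \<omega>))\<^sup>2 \<le> ?c * (norm (Y t \<omega>))\<^sup>2" for t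
    unfolding power_mult_distrib[symmetric]
    by (intro AE_I2 power_mono onorm) auto
  have "(\<lambda>t. ?c * (\<integral>\<omega>. (norm (Y t \<omega>))\<^sup>2 \<partial>M)) \<longlonglongrightarrow> ?c * 0"
    using assms by (intro tendsto_intros) (auto simp: l2_null_def)
  then show "(\<lambda>t. \<integral>\<omega>. ?c * (norm (Y t \<omega>))\<^sup>2 \<partial>M) \<longlonglongrightarrow> 0" by simp
qed

lemma l2_null_scaleR:
  assumes "l2_null M Y"
  shows "l2_null M (\<lambda>t \<omega>. c *\<^sub>R Y t \<omega>)"
  using l2_null_mult_vector[OF assms, of "c *\<^sub>R mat 1"]
  by (simp add: scaleR_matrix_vector_assoc[symmetric])

text \<open>An almost sure bound is enough, so the factor may be correlated with
  \<open>Y\<close>.\<close>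

lemma l2_null_bounded_scaleR:
  assumes Y: "l2_null M Y" and w: "\<And>t. w t \<in> borel_measurable M"
    and le: "\<And>t. AE \<omega> in M. \<bar>w t \<omega>\<bar> \<le> 1"
  shows "l2_null M (\<lambda>t \<omega>. w t \<omega> *\<^sub>R Y t \<omega>)"
proof (rule l2_null_dominated)
  show "(\<lambda>\<omega>. w t \<omega> *\<^sub>R Y t \<omega>) \<in> borel_measurable M" for t
    by (intro borel_measurable_scaleR w l2_null_measurable[OF Y])
  show "integrable M (\<lambda>\<omega>. (norm (Y t \<omega>))\<^sup>2)" for t
    using Y by (auto simp: l2_null_def square_integrable_def)
  show "AE \<omega> in M. (norm (w t \<omega> *\<^sub>R Y t \<omega>))\<^sup>2 \<le> (norm (Y t \<omega>))\<^sup>2" for t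
    using le[of t] by eventually_elim (simp add: mult_left_le_one_le power_mono)
  show "(\<lambda>t. \<integral>\<omega>. (norm (Y t \<omega>))\<^sup>2 \<partial>M) \<longlonglongrightarrow> 0"
    using Y by (simp add: l2_null_def)
qed

lemma l2_null_shift:
  assumes "l2_null M (\<lambda>t. Y (t + k))" and "\<And>t. square_integrable M (Y t)"
  shows "l2_null M Y"
  using assms by (auto simp: l2_null_def intro: LIMSEQ_offset)

lemma square_integrable_bounded_scaleR:
  assumes "square_integrable M Y" "w \<in> borel_measurable M" "AE \<omega> in M. \<bar>w \<omega>\<bar> \<le> 1"
  shows "square_integrable M (\<lambda>\<omega>. w \<omega> *\<^sub>R Y \<omega>)"
proof -
  have int: "integrable M (\<lambda>\<omega>. (norm (Y \<omega>))\<^sup>2)"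
    and [measurable]: "Y \<in> borel_measurable M" "w \<in> borel_measurable M"
    using assms by (auto simp: square_integrable_def)
  have "integrable M (\<lambda>\<omega>. (norm (w \<omega> *\<^sub>R Y \<omega>))\<^sup>2)"
  proof (rule Bochner_Integration.integrable_bound[OF int])
    show "AE \<omega> in M. norm ((norm (w \<omega> *\<^sub>R Y \<omega>))\<^sup>2) \<le> norm ((norm (Y \<omega>))\<^sup>2)"
      using assms(3) by eventually_elim (simp add: mult_left_le_one_le power_mono)
  qed measurable
  then show ?thesis by (simp add: square_integrable_def)
qed


section \<open>A single mode of the closed loop\<close>

text \<open>The atoms at 0 and 1 carry total mass 1, so \<open>h (\<gamma> k)\<close> agrees almost
  everywhere with a combination of two indicators.\<close>

lemma bernoulli_process_moments:
  assumes "bernoulli_process M p \<gamma>"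
  shows "AE \<omega> in M. \<gamma> k \<omega> = 0 \<or> \<gamma> k \<omega> = 1"
    and "h \<in> borel_measurable borel \<Longrightarrow> integrable M (\<lambda>\<omega>. h (\<gamma> k \<omega>))"
    and "h \<in> borel_measurable borel \<Longrightarrow> (\<integral>\<omega>. h (\<gamma> k \<omega>) \<partial>M) = h 0 * p + h 1 * (1 - p)"
proof -
  interpret prob_space M using assms by (simp add: bernoulli_process_def)
  have [measurable]: "\<gamma> k \<in> borel_measurable M"
    using assms by (auto simp: bernoulli_process_def indep_vars_def)
  define S where "S c = {\<omega> \<in> space M. \<gamma> k \<omega> = c}" for c
  have [measurable]: "S c \<in> sets M" for c unfolding S_def by measurable
  have p: "prob (S 0) = p" "prob (S 1) = 1 - p"
    using assms by (auto simp: bernoulli_process_def S_def)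
  have "prob (S 0 \<union> S 1) = 1"
    by (subst finite_measure_Union) (auto simp: p, auto simp: S_def)
  from AE_prob_1[OF this] show ae: "AE \<omega> in M. \<gamma> k \<omega> = 0 \<or> \<gamma> k \<omega> = 1"
    by eventually_elim (auto simp: S_def)
  assume [measurable]: "h \<in> borel_measurable borel"
  let ?g = "\<lambda>\<omega>. h 0 * indicator (S 0) \<omega> + h 1 * indicator (S 1) \<omega>"
  have eq: "AE \<omega> in M. h (\<gamma> k \<omega>) = ?g \<omega>"
    using ae AE_space by eventually_elim (auto simp: S_def indicator_def)
  have int: "integrable M ?g"
    by (intro Bochner_Integration.integrable_add integrable_mult_right integrable_real_indicator)
      (auto simp: emeasure_eq_measure)
  show "integrable M (\<lambda>\<omega>. h (\<gamma> k \<omega>))"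
    by (rule integrable_cong_AE_imp[OF int]) (use eq in auto)
  have "(\<integral>\<omega>. h (\<gamma> k \<omega>) \<partial>M) = (\<integral>\<omega>. ?g \<omega> \<partial>M)"
    by (rule integral_cong_AE) (use eq in auto)
  also have "\<dots> = h 0 * p + h 1 * (1 - p)"
    by (subst Bochner_Integration.integral_add) (auto simp: p emeasure_eq_measure Int_absorb2 sets.sets_into_space)
  finally show "(\<integral>\<omega>. h (\<gamma> k \<omega>) \<partial>M) = h 0 * p + h 1 * (1 - p)" .
qed

locale delayed_mode = prob_space M
  for M :: "'a measure" +
  fixes \<gamma> :: "nat \<Rightarrow> 'a \<Rightarrow> real" and p :: real
    and A :: "real ^ 'n ^ 'n" and B :: "real ^ 'm ^ 'n" and d :: nat
    and K :: "real ^ 'n ^ 'm" and l :: real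
    and x0 :: "real ^ 'n" and u0 :: "nat \<Rightarrow> real ^ 'm"
    and x :: "nat \<Rightarrow> 'a \<Rightarrow> real ^ 'n" and u :: "int \<Rightarrow> 'a \<Rightarrow> real ^ 'm"
  assumes bernoulli: "bernoulli_process M p \<gamma>" and p: "0 < p" "p < 1"
    and x_0: "\<omega> \<in> space M \<Longrightarrow> x 0 \<omega> = x0"
    and u_init: "\<omega> \<in> space M \<Longrightarrow> s \<in> {1..d} \<Longrightarrow> u (- int s) \<omega> = u0 s"
    and x_Suc: "\<omega> \<in> space M \<Longrightarrow> x (Suc k) \<omega> = A *v x k \<omega> + \<gamma> k \<omega> *\<^sub>R (B *v u (int k - int d) \<omega>)"
    and u_feedback: "\<omega> \<in> space M \<Longrightarrow> d \<le> k \<Longrightarrow>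
      u (int k - int d) \<omega> = - l *\<^sub>R (K *v predictor A B d p (\<lambda>k. x k \<omega>) (\<lambda>t. u t \<omega>) k)"
begin

definition D :: "real ^ 'm ^ 'n" where
  "D = matpow A d ** B"

text \<open>\<open>y t\<close> is the prediction \<open>\<hat>x(t+d|t)\<close>; it only depends on \<open>\<gamma>(0), \<dots>, \<gamma>(t-1)\<close>.\<close>

definition y :: "nat \<Rightarrow> 'a \<Rightarrow> real ^ 'n" where
  "y t \<omega> = predictor A B d p (\<lambda>k. x k \<omega>) (\<lambda>s. u s \<omega>) (t + d)"

lemma gamma_measurable [measurable]: "\<gamma> k \<in> borel_measurable M"
  using bernoulli by (auto simp: bernoulli_process_def indep_vars_def)

lemma gamma_bounds:
  "AE \<omega> in M. \<bar>\<gamma> k \<omega>\<bar> \<le> 1" "AE \<omega> in M. \<bar>\<gamma> k \<omega> - (1 - p)\<bar> \<le> 1"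
  using bernoulli_process_moments(1)[OF bernoulli, of k] p by (auto elim!: eventually_mono)

lemma y_eq:
  "y t \<omega> = matpow A d *v x t \<omega> +
    (1 - p) *\<^sub>R (\<Sum>i<d. matpow A i *v (B *v u (int t - 1 - int i) \<omega>))"
  by (simp add: y_def predictor_def sum.atLeast1_atMost_eq algebra_simps)

lemma u_eq: "\<omega> \<in> space M \<Longrightarrow> u (int t) \<omega> = - l *\<^sub>R (K *v y t \<omega>)"
  using u_feedback[of \<omega> "t + d"] by (simp add: y_def)

text \<open>Both sides are the sum of \<open>f i (t - i)\<close> over \<open>i\<close> from 0 to
  \<open>d\<close>, split at its last and at its first term. It advances the window of pending
  inputs by one step, in the prediction and in the Lyapunov functional alike.\<close>

lemma input_sum_shift:
  "(\<Sum>i<d. f i (int (Suc t) - 1 - int i)) + f d (int t - int d) =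
    f 0 (int t) + (\<Sum>i<d. f (Suc i) (int t - 1 - int i))" for f :: "nat \<Rightarrow> int \<Rightarrow> 'b :: comm_monoid_add"
proof -
  have "(\<Sum>i<d. f i (int (Suc t) - 1 - int i)) + f d (int t - int d) = (\<Sum>i<Suc d. f i (int t - int i))"
    by simp
  also have "\<dots> = f 0 (int t) + (\<Sum>i<d. f (Suc i) (int t - int (Suc i)))"
    by (subst sum.lessThan_Suc_shift) simp
  finally show ?thesis by (simp add: algebra_simps)
qed

text \<open>The prediction carries the oldest pending input \<open>u(t-d)\<close> with the mean
  coefficient \<open>1 - p\<close>; knowing \<open>\<gamma>(t)\<close> corrects this to the true
  one. The new input \<open>u(t)\<close> enters with its mean. For \<open>d = 0\<close> the two
  inputs coincide.\<close>

lemma y_Suc: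
  assumes "\<omega> \<in> space M"
  shows "y (Suc t) \<omega> = (A *v y t \<omega> + (1 - p) *\<^sub>R (B *v u (int t) \<omega>)) +
    (\<gamma> t \<omega> - (1 - p)) *\<^sub>R (D *v u (int t - int d) \<omega>)"
proof -
  define f where "f i s = matpow A i *v (B *v u s \<omega>)" for i s
  have Ay: "A *v y t \<omega> = matpow A d *v (A *v x t \<omega>) + (1 - p) *\<^sub>R (\<Sum>i<d. f (Suc i) (int t - 1 - int i))"
    by (simp add: y_eq f_def matrix_vector_right_distrib matrix_vector_mult_scaleR
        linear_sum[OF matrix_vector_mul_linear] matrix_vector_mul_assoc matpow_commute matrix_mul_assoc)
  have yS: "y (Suc t) \<omega> = matpow A d *v (A *v x t \<omega>) + \<gamma> t \<omega> *\<^sub>R f d (int t - int d) +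
      (1 - p) *\<^sub>R (\<Sum>i<d. f i (int (Suc t) - 1 - int i))"
    unfolding y_eq x_Suc[OF assms] f_def
    by (simp add: matrix_vector_right_distrib matrix_vector_mult_scaleR)
  have S0: "(\<Sum>i<d. f i (int (Suc t) - 1 - int i)) =
      f 0 (int t) + (\<Sum>i<d. f (Suc i) (int t - 1 - int i)) - f d (int t - int d)"
    using input_sum_shift[of f t] by (simp add: algebra_simps)
  have f: "f 0 (int t) = B *v u (int t) \<omega>" "f d (int t - int d) = D *v u (int t - int d) \<omega>"
    by (simp_all add: f_def D_def matrix_vector_mul_assoc)
  show ?thesis
    unfolding yS S0 Ay f by (simp add: scaleR_right_distrib scaleR_right_diff_distrib scaleR_left_diff_distrib)
qed

lemma x_shift:
  assumes "\<omega> \<in> space M"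
  shows "x (t + e) \<omega> = matpow A e *v x t \<omega> +
    (\<Sum>i<e. \<gamma> (t + e - Suc i) \<omega> *\<^sub>R (matpow A i *v (B *v u (int (t + e - Suc i) - int d) \<omega>)))"
proof (induction e)
  case (Suc e)
  have "x (t + Suc e) \<omega> = A *v x (t + e) \<omega> + \<gamma> (t + e) \<omega> *\<^sub>R (B *v u (int (t + e) - int d) \<omega>)"
    using x_Suc[OF assms] by simp
  then show ?case
    unfolding Suc sum.lessThan_Suc_shift
    by (simp add: matrix_vector_right_distrib matrix_vector_mult_scaleR
        linear_sum[OF matrix_vector_mul_linear] matrix_vector_mul_assoc matrix_mul_assoc)
qed simp

text \<open>The prediction error: each pending input, weighted by the deviation of its coefficient
  from the mean. It transfers convergence from predictions to states.\<close>

lemma x_eq_y: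
  assumes "\<omega> \<in> space M"
  shows "x (t + d) \<omega> = y t \<omega> + (\<Sum>i<d. (\<gamma> (t + d - Suc i) \<omega> - (1 - p)) *\<^sub>R
    ((matpow A i ** B) *v u (int t - 1 - int i) \<omega>))"
proof -
  have "(\<Sum>i<d. \<gamma> (t + d - Suc i) \<omega> *\<^sub>R (matpow A i *v (B *v u (int (t + d - Suc i) - int d) \<omega>))) =
      (\<Sum>i<d. \<gamma> (t + d - Suc i) \<omega> *\<^sub>R (matpow A i *v (B *v u (int t - 1 - int i) \<omega>)))"
  proof (intro sum.cong refl)
    fix i assume "i \<in> {..<d}"
    \<comment> \<open>The truncated subtraction on \<open>nat\<close> is exact because
      \<open>i < d\<close>.\<close>
    then have "int (t + d - Suc i) - int d = int t - 1 - int i" by auto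
    then show "\<gamma> (t + d - Suc i) \<omega> *\<^sub>R (matpow A i *v (B *v u (int (t + d - Suc i) - int d) \<omega>)) =
        \<gamma> (t + d - Suc i) \<omega> *\<^sub>R (matpow A i *v (B *v u (int t - 1 - int i) \<omega>))"
      by (simp only:)
  qed
  then show ?thesis
    unfolding x_shift[OF assms, of t d] y_eq
    by (simp add: matrix_vector_mul_assoc scaleR_left_diff_distrib sum_subtractf scaleR_sum_right)
qed

lemma adapted_cong:
  assumes "Z \<in> borel_measurable (past M \<gamma> t)" "square_integrable M Z"
    and "\<And>\<omega>. \<omega> \<in> space M \<Longrightarrow> Y \<omega> = Z \<omega>"
  shows "Y \<in> borel_measurable (past M \<gamma> t) \<and> square_integrable M Y"
proof -
  have "Y \<in> borel_measurable (past M \<gamma> t) \<longleftrightarrow> Z \<in> borel_measurable (past M \<gamma> t)"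
    by (rule measurable_cong) (simp add: assms(3))
  moreover have "square_integrable M Y = square_integrable M Z"
    by (rule square_integrable_cong) (rule assms(3))
  ultimately show ?thesis using assms(1,2) by blast
qed

text \<open>Stated relative to adaptedness of \<open>y\<close> up to time \<open>t\<close>, because
  it is applied inside the induction that proves this adaptedness.\<close>

lemma u_adapted_if:
  assumes y: "\<And>t'. t' \<le> t \<Longrightarrow> y t' \<in> borel_measurable (past M \<gamma> t') \<and> square_integrable M (y t')"
    and s: "- int d \<le> s" "s \<le> int t"
  shows "u s \<in> borel_measurable (past M \<gamma> t) \<and> square_integrable M (u s)"
proof (cases "s < 0")
  case True
  have "- int (nat (- s)) = s" "nat (- s) \<in> {1..d}"
    using True s by (simp_all add: nat_le_iff Suc_le_eq)
  then have eq: "u s \<omega> = u0 (nat (- s))" if "\<omega> \<in> space M" for \<omega>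
    using u_init[OF that, of "nat (- s)"] by simp
  show ?thesis
    by (rule adapted_cong[OF _ _ eq]) (simp_all add: finite_measure_axioms)
next
  case False
  define t' where "t' = nat s"
  have s': "s = int t'" "t' \<le> t" using False s by (auto simp: t'_def)
  have [measurable]: "y t' \<in> borel_measurable (past M \<gamma> t)"
    using y[OF s'(2)] measurable_past_mono[OF _ s'(2)] by blast
  have sq: "square_integrable M (\<lambda>\<omega>. - l *\<^sub>R (K *v y t' \<omega>))"
    using y[OF s'(2)] by (intro square_integrable_scaleR square_integrable_mult_vector) blast
  have meas: "(\<lambda>\<omega>. - l *\<^sub>R (K *v y t' \<omega>)) \<in> borel_measurable (past M \<gamma> t)"
    by measurable
  show ?thesis
    unfolding s'(1) by (rule adapted_cong[OF meas sq u_eq])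
qed

lemma noise_moments:
  "integrable M (\<lambda>\<omega>. (\<gamma> k \<omega> - (1 - p))\<^sup>2)"
  "expectation (\<lambda>\<omega>. \<gamma> k \<omega> - (1 - p)) = 0"
  "expectation (\<lambda>\<omega>. (\<gamma> k \<omega> - (1 - p))\<^sup>2) = p * (1 - p)"
  using bernoulli_process_moments(2)[OF bernoulli, of "\<lambda>x. (x - (1 - p))\<^sup>2" k]
    bernoulli_process_moments(3)[OF bernoulli, of "\<lambda>x. (x - (1 - p))" k]
    bernoulli_process_moments(3)[OF bernoulli, of "\<lambda>x. (x - (1 - p))\<^sup>2" k]
  by (simp_all add: algebra_simps power2_eq_square)

lemma gamma_indep: "indep_vars (\<lambda>_. borel) \<gamma> UNIV"
  using bernoulli by (simp add: bernoulli_process_def)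

text \<open>Measurability and integrability start from constant initial values and pass through
  \<open>y_Suc\<close>. Strong induction is used because \<open>u(t-d)\<close> is a feedback of an
  earlier \<open>y\<close>.\<close>

lemma y_adapted: "y t \<in> borel_measurable (past M \<gamma> t) \<and> square_integrable M (y t)"
proof (induction t rule: less_induct)
  case (less t)
  show ?case
  proof (cases t)
    case 0
    let ?c = "matpow A d *v x0 + (1 - p) *\<^sub>R (\<Sum>i<d. matpow A i *v (B *v u0 (Suc i)))"
    have eq: "y t \<omega> = ?c" if "\<omega> \<in> space M" for \<omega>
    proof -
      have "u (- 1 - int i) \<omega> = u0 (Suc i)" if "i < d" for i
        using u_init[OF \<open>\<omega> \<in> space M\<close>, of "Suc i"] that by (simp add: algebra_simps)
      then show ?thesis
        by (simp add: 0 y_eq x_0[OF that])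
    qed
    show ?thesis
      by (rule adapted_cong[OF _ _ eq]) (simp_all add: finite_measure_axioms)
  next
    case (Suc n)
    let ?U = "\<lambda>\<omega>. A *v y n \<omega> + (1 - p) *\<^sub>R (B *v u (int n) \<omega>)" and ?V = "\<lambda>\<omega>. D *v u (int n - int d) \<omega>"
    have y: "y n \<in> borel_measurable (past M \<gamma> n)" "square_integrable M (y n)"
      using less[of n] Suc by auto
    have u: "u (int n) \<in> borel_measurable (past M \<gamma> n)" "square_integrable M (u (int n))"
      "u (int n - int d) \<in> borel_measurable (past M \<gamma> n)" "square_integrable M (u (int n - int d))"
      using u_adapted_if[of n "int n"] u_adapted_if[of n "int n - int d"] less Suc by auto
    have UV: "?U \<in> borel_measurable (past M \<gamma> n)" "?V \<in> borel_measurable (past M \<gamma> n)"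
      using y(1) u(1,3) by measurable
    have sq: "square_integrable M (\<lambda>\<omega>. ?U \<omega> + (\<gamma> n \<omega> - (1 - p)) *\<^sub>R ?V \<omega>)"
      by (rule noise_step(1)[where f = "\<lambda>x. x - (1 - p)" and s = "p * (1 - p)", OF gamma_indep UV(1) _ UV(2)])
        (simp_all add: noise_moments y u square_integrable_add square_integrable_mult_vector square_integrable_scaleR)
    have meas: "(\<lambda>\<omega>. ?U \<omega> + (\<gamma> n \<omega> - (1 - p)) *\<^sub>R ?V \<omega>) \<in> borel_measurable (past M \<gamma> t)"
    proof -
      have "\<gamma> n \<in> borel_measurable (past M \<gamma> t)"
        by (rule measurable_past_component) (simp add: Suc)
      moreover have "?U \<in> borel_measurable (past M \<gamma> t)" "?V \<in> borel_measurable (past M \<gamma> t)"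
        using UV by (auto simp: Suc intro: measurable_past_mono)
      ultimately show ?thesis by measurable
    qed
    show ?thesis
      using adapted_cong[OF meas sq y_Suc] by (simp only: Suc)
  qed
qed

lemma u_adapted:
  assumes "- int d \<le> s" "s \<le> int t"
  shows "u s \<in> borel_measurable (past M \<gamma> t)" "square_integrable M (u s)"
  using u_adapted_if[OF y_adapted assms] by auto

lemma square_integrable_u: "- int d \<le> s \<Longrightarrow> square_integrable M (u s)"
  using u_adapted(2)[of s "nat s"] by simp

text \<open>\<open>l2_null\<close> demands integrability at all times, and \<open>x_eq_y\<close>
  does not reach the first \<open>d\<close> states.\<close>

lemma square_integrable_x: "square_integrable M (x k)"
proof (induction k)
  case 0
  have "square_integrable M (x 0) = square_integrable M (\<lambda>_. x0)"
    by (rule square_integrable_cong) (rule x_0)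
  then show ?case by (simp add: finite_measure_axioms)
next
  case (Suc k)
  have "square_integrable M (x (Suc k)) =
      square_integrable M (\<lambda>\<omega>. A *v x k \<omega> + \<gamma> k \<omega> *\<^sub>R (B *v u (int k - int d) \<omega>))"
    by (rule square_integrable_cong) (rule x_Suc)
  then show ?case
    by (simp add: square_integrable_add square_integrable_mult_vector Suc
        square_integrable_bounded_scaleR square_integrable_u gamma_bounds)
qed

text \<open>
  Lyapunov functional: besides \<open>y(t)\<close> it charges the pending inputs \<open>u(t-1), \<dots>, u(t-d)\<close>, which
  enter \<open>y\<close> multiplied by noise that has not yet been realised.
\<close>

lemma l2_null_y:
  assumes P: "pos_semidef P" and "0 < \<epsilon>"
    and lyap: "\<And>v. qform P (A *v v - ((1 - p) * l) *\<^sub>R (B *v (K *v v)))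
      + p * (1 - p) * l\<^sup>2 * qform P (D *v (K *v v)) \<le> qform P v - \<epsilon> * (norm v)\<^sup>2"
  shows "l2_null M y"
proof -
  let ?s = "p * (1 - p)"
  define q where "q s = expectation (\<lambda>\<omega>. qform P (D *v u s \<omega>))" for s
  define V where "V t = expectation (\<lambda>\<omega>. qform P (y t \<omega>)) + ?s * (\<Sum>i<d. q (int t - 1 - int i))" for t
  define n where "n t = expectation (\<lambda>\<omega>. (norm (y t \<omega>))\<^sup>2)" for t
  have s0: "0 \<le> ?s" using p by simp
  have sq_y: "square_integrable M (y t)" for t using y_adapted by blast
  have decrease: "V (Suc t) \<le> V t - \<epsilon> * n t" for t
  proof -
    let ?U = "\<lambda>\<omega>. A *v y t \<omega> + (1 - p) *\<^sub>R (B *v u (int t) \<omega>)"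
    let ?V = "\<lambda>\<omega>. D *v u (int t - int d) \<omega>"
    let ?W = "\<lambda>\<omega>. A *v y t \<omega> - ((1 - p) * l) *\<^sub>R (B *v (K *v y t \<omega>))"
    have UV: "?U \<in> borel_measurable (past M \<gamma> t)" "?V \<in> borel_measurable (past M \<gamma> t)"
      using y_adapted[of t] u_adapted(1)[of "int t" t] u_adapted(1)[of "int t - int d" t] by auto
    have sqUV: "square_integrable M ?U" "square_integrable M ?V"
      by (intro square_integrable_add square_integrable_mult_vector square_integrable_scaleR sq_y
          square_integrable_u; simp)+
    have "expectation (\<lambda>\<omega>. qform P (y (Suc t) \<omega>)) =
        expectation (\<lambda>\<omega>. qform P (?U \<omega> + (\<gamma> t \<omega> - (1 - p)) *\<^sub>R ?V \<omega>))"
      by (intro Bochner_Integration.integral_cong refl) (simp add: y_Suc)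
    also have "\<dots> = expectation (\<lambda>\<omega>. qform P (?U \<omega>)) + ?s * q (int t - int d)"
      unfolding q_def
      by (rule noise_step(2)[where f = "\<lambda>x. x - (1 - p)", OF gamma_indep UV(1) sqUV(1) UV(2) sqUV(2)])
        (simp_all add: noise_moments pos_semidef_symmetric[OF P])
    also have "expectation (\<lambda>\<omega>. qform P (?U \<omega>)) = expectation (\<lambda>\<omega>. qform P (?W \<omega>))"
      by (intro Bochner_Integration.integral_cong refl)
        (simp only: u_eq matrix_vector_mult_scaleR scaleR_scaleR, simp)
    finally have 1: "expectation (\<lambda>\<omega>. qform P (y (Suc t) \<omega>)) =
        expectation (\<lambda>\<omega>. qform P (?W \<omega>)) + ?s * q (int t - int d)" .
    have 2: "q (int t) = expectation (\<lambda>\<omega>. l\<^sup>2 * qform P (D *v (K *v y t \<omega>)))"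
      unfolding q_def
    proof (intro Bochner_Integration.integral_cong refl)
      fix \<omega> assume "\<omega> \<in> space M"
      then have "D *v u (int t) \<omega> = (- l) *\<^sub>R (D *v (K *v y t \<omega>))"
        by (simp only: u_eq matrix_vector_mult_scaleR)
      then show "qform P (D *v u (int t) \<omega>) = l\<^sup>2 * qform P (D *v (K *v y t \<omega>))"
        by (simp only: qform_scaleR power2_minus)
    qed
    have sqW: "square_integrable M ?W"
      using square_integrable_add[OF square_integrable_mult_vector[OF sq_y]
          square_integrable_scaleR[OF square_integrable_mult_vector[OF square_integrable_mult_vector[OF sq_y]]],
          of A t "- ((1 - p) * l)" B K t] by simp
    have sqD: "square_integrable M (\<lambda>\<omega>. D *v (K *v y t \<omega>))"
      by (intro square_integrable_mult_vector sq_y)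
    have "expectation (\<lambda>\<omega>. qform P (?W \<omega>)) + ?s * q (int t) =
        expectation (\<lambda>\<omega>. qform P (?W \<omega>) + ?s * l\<^sup>2 * qform P (D *v (K *v y t \<omega>)))"
      unfolding 2 using integrable_qform[OF sqW] integrable_qform[OF sqD] by simp
    also have "\<dots> \<le> expectation (\<lambda>\<omega>. qform P (y t \<omega>) - \<epsilon> * (norm (y t \<omega>))\<^sup>2)"
      using integrable_qform[OF sqW, of P] integrable_qform[OF sqD, of P] integrable_qform[OF sq_y, of P t]
        sq_y[of t]
      by (intro integral_mono lyap) (auto simp: square_integrable_def)
    also have "\<dots> = expectation (\<lambda>\<omega>. qform P (y t \<omega>)) - \<epsilon> * n t"
      unfolding n_def using integrable_qform[OF sq_y, of P t] sq_y[of t]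
      by (simp add: square_integrable_def)
    finally have 3: "expectation (\<lambda>\<omega>. qform P (?W \<omega>)) + ?s * q (int t) \<le>
        expectation (\<lambda>\<omega>. qform P (y t \<omega>)) - \<epsilon> * n t" .
    \<comment> \<open>The input \<open>u(t)\<close> joins the window of pending inputs, and
      \<open>u(t-d)\<close> leaves it with exactly the noise term that it has just
      contributed.\<close>
    have "?s * (\<Sum>i<d. q (int (Suc t) - 1 - int i)) + ?s * q (int t - int d) =
        ?s * q (int t) + ?s * (\<Sum>i<d. q (int t - 1 - int i))"
      using input_sum_shift[of "\<lambda>_. q" t] unfolding distrib_left[symmetric] by simp
    then show ?thesis
      unfolding V_def 1 using 3 by linarith
  qed
  have V0: "0 \<le> V t" for t
    unfolding V_def q_def
    by (intro add_nonneg_nonneg mult_nonneg_nonneg[OF s0] sum_nonneg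
        Bochner_Integration.integral_nonneg pos_semidef_nonneg P)
  \<comment> \<open>Telescoping makes the second moments summable, hence convergent to 0, without a
    decay rate.\<close>
  have "(\<Sum>t<T. \<epsilon> * n t) \<le> V 0 - V T" for T
  proof (induction T)
    case (Suc T)
    then show ?case using decrease[of T] by simp
  qed simp
  then have "(\<Sum>t<T. \<epsilon> * n t) \<le> V 0" for T
    using V0[of T] by (meson diff_le_eq le_add_same_cancel1 order_trans)
  moreover have "0 \<le> \<epsilon> * n t" for t
    using \<open>0 < \<epsilon>\<close> by (simp add: n_def)
  ultimately have "summable (\<lambda>t. \<epsilon> * n t)"
    by (rule summableI_nonneg_bounded[rotated])
  then have "n \<longlonglongrightarrow> 0"
    using \<open>0 < \<epsilon>\<close> by (simp add: summable_LIMSEQ_zero)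
  then show ?thesis
    using sq_y by (simp add: l2_null_def n_def[abs_def])
qed

text \<open>By \<open>x_eq_y\<close> the state differs from the prediction by \<open>d\<close>
  inputs with bounded random factors, and from time 0 on these inputs are feedbacks of
  \<open>y\<close>.\<close>

lemma l2_null_x:
  assumes "l2_null M y"
  shows "l2_null M x"
proof -
  \<comment> \<open>Before time \<open>Suc i\<close> the index is negative and the input is an
    initial value; there square integrability is enough.\<close>
  have u: "l2_null M (\<lambda>t. u (int t - 1 - int i))" if "i < d" for i
  proof (rule l2_null_shift[where k = "Suc i"])
    have "l2_null M (\<lambda>t \<omega>. - l *\<^sub>R (K *v y t \<omega>))"
      by (intro l2_null_scaleR l2_null_mult_vector assms)
    then have "l2_null M (\<lambda>t. u (int t))"
      by (subst l2_null_cong[where Z = "\<lambda>t \<omega>. - l *\<^sub>R (K *v y t \<omega>)"]) (simp_all only: u_eq)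
    then show "l2_null M (\<lambda>t. u (int (t + Suc i) - 1 - int i))" by simp
    show "square_integrable M (u (int t - 1 - int i))" for t
      using that by (intro square_integrable_u) simp
  qed
  have "l2_null M (\<lambda>t \<omega>. y t \<omega> + (\<Sum>i<d. (\<gamma> (t + d - Suc i) \<omega> - (1 - p)) *\<^sub>R
    ((matpow A i ** B) *v u (int t - 1 - int i) \<omega>)))"
    by (intro l2_null_add l2_null_sum assms l2_null_bounded_scaleR l2_null_mult_vector u gamma_bounds) auto
  then have "l2_null M (\<lambda>t. x (t + d))"
    by (subst l2_null_cong[OF x_eq_y])
  then show ?thesis
    by (rule l2_null_shift) (rule square_integrable_x)
qed

end


section \<open>Consensus\<close>

text \<open>Symmetry of \<open>a\<close> moves the Laplacian from the vectors \<open>z\<close> to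
  the weights \<open>e\<close>, on which it acts as the scalar \<open>l\<close>. The protocol uses
  \<open>z j - z v\<close>, hence the minus sign.\<close>

lemma eigenvector_laplacian_sum:
  fixes a :: "real ^ 'v ^ 'v" and z :: "'v \<Rightarrow> real ^ 'n"
  assumes a: "weighted_graph a" and eig: "laplacian a *v e = l *\<^sub>R e"
  shows "(\<Sum>v\<in>UNIV. e $ v *\<^sub>R (\<Sum>j\<in>neighbours a v. a $ v $ j *\<^sub>R (z j - z v))) =
    - l *\<^sub>R (\<Sum>v\<in>UNIV. e $ v *\<^sub>R z v)"
proof -
  have sym: "a $ i $ j = a $ j $ i" for i j
    using a unfolding weighted_graph_def by (metis transpose_def vec_lambda_beta)
  have zero: "a $ v $ j = 0" if "j \<notin> neighbours a v" for v j
    using a that by (metis weighted_graph_def neighbours_def mem_Collect_eq order_le_less)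
  have "(\<Sum>j\<in>neighbours a v. a $ v $ j *\<^sub>R (z j - z v)) = (\<Sum>j\<in>UNIV. a $ v $ j *\<^sub>R (z j - z v))" for v
    by (rule sum.mono_neutral_left) (auto simp: zero)
  then have "(\<Sum>v\<in>UNIV. e $ v *\<^sub>R (\<Sum>j\<in>neighbours a v. a $ v $ j *\<^sub>R (z j - z v))) =
      (\<Sum>v\<in>UNIV. \<Sum>j\<in>UNIV. (e $ v * a $ v $ j) *\<^sub>R z j) - (\<Sum>v\<in>UNIV. \<Sum>j\<in>UNIV. (e $ v * a $ v $ j) *\<^sub>R z v)"
    by (simp add: scaleR_sum_right scaleR_diff_right sum_subtractf)
  also have "(\<Sum>v\<in>UNIV. \<Sum>j\<in>UNIV. (e $ v * a $ v $ j) *\<^sub>R z j) =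
      (\<Sum>j\<in>UNIV. \<Sum>v\<in>UNIV. (e $ v * a $ j $ v) *\<^sub>R z j)"
    by (subst sum.swap) (intro sum.cong refl, simp add: sym)
  also have "\<dots> - (\<Sum>v\<in>UNIV. \<Sum>j\<in>UNIV. (e $ v * a $ v $ j) *\<^sub>R z v) =
      - (\<Sum>v\<in>UNIV. (laplacian a *v e) $ v *\<^sub>R z v)"
    unfolding laplacian_mult sum_subtractf[symmetric] sum_negf[symmetric]
    by (intro sum.cong refl)
      (simp add: scaleR_left.sum sum_subtractf sum_negf[symmetric] right_diff_distrib scaleR_left_diff_distrib mult.commute)
  also have "\<dots> = - l *\<^sub>R (\<Sum>v\<in>UNIV. e $ v *\<^sub>R z v)"
    by (simp add: eig scaleR_sum_right sum_negf)
  finally show ?thesis .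
qed

lemma predictor_sum:
  "predictor A B d p (\<lambda>k. \<Sum>v\<in>I. c v *\<^sub>R x v k) (\<lambda>t. \<Sum>v\<in>I. c v *\<^sub>R u v t) k =
    (\<Sum>v\<in>I. c v *\<^sub>R predictor A B d p (x v) (u v) k)"
proof -
  have "(\<Sum>j=1..d. \<Sum>v\<in>I. c v *\<^sub>R (matpow A (j - 1) *v (B *v u v (int k - int d - int j)))) =
      (\<Sum>v\<in>I. \<Sum>j=1..d. c v *\<^sub>R (matpow A (j - 1) *v (B *v u v (int k - int d - int j))))"
    by (rule sum.swap)
  then show ?thesis
    by (simp add: predictor_def linear_sum[OF matrix_vector_mul_linear] matrix_vector_mult_scaleR
        scaleR_sum_right sum.distrib scaleR_add_right mult.commute)
qed

text \<open>Since \<open>\<mu>\<^sup>2 + \<sigma>\<^sup>2 = \<mu>\<close>, the optimal scaling of the gain is \<open>2 / (\<lambda>\<^sub>2 + \<lambda>\<^sub>N)\<close>.\<close>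

lemma gamma_2_le:
  fixes a :: "real ^ 'v ^ 'v"
  assumes "0 < p" "p < 1" and l2: "0 < eigval 2 (laplacian a)"
    and l: "eigval 2 (laplacian a) \<le> l" "l \<le> eigval CARD('v) (laplacian a)"
    and c: "c = l * (2 / (eigval 2 (laplacian a) + eigval CARD('v) (laplacian a)))"
  shows "gamma_2 p a \<le> 2 * (1 - p) * c - ((1 - p)\<^sup>2 + p * (1 - p)) * c\<^sup>2"
proof -
  define m N where "m = eigval 2 (laplacian a)" and "N = eigval CARD('v) (laplacian a)"
  have pos: "0 < m" "m \<le> l" "l \<le> N" using l2 l by (auto simp: m_def N_def)
  have mu: "(1 - p)\<^sup>2 + p * (1 - p) = 1 - p" by (simp add: power2_eq_square algebra_simps)
  have frac: "(1 - p)\<^sup>2 / (1 - p) = 1 - p" using assms by (simp add: power2_eq_square)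
  have "gamma_2 p a = (1 - p)\<^sup>2 / ((1 - p)\<^sup>2 + p * (1 - p)) * (1 - ((N - m) / (N + m))\<^sup>2)"
    by (simp only: gamma_2_def Let_def m_def N_def)
  also have "\<dots> = (1 - p) * (1 - ((N - m) / (N + m))\<^sup>2)"
    by (simp only: mu frac)
  also have "\<dots> \<le> (1 - p) * (1 - (1 - c)\<^sup>2)"
  proof -
    \<comment> \<open>Affine in \<open>l\<close>, with opposite values at the extremes
      \<open>m\<close> and \<open>N\<close>, so the absolute value is largest there.\<close>
    have "1 - c = (N + m - 2 * l) / (N + m)"
      using pos unfolding c m_def[symmetric] N_def[symmetric] by (simp add: field_simps)
    then have "\<bar>1 - c\<bar> = \<bar>N + m - 2 * l\<bar> / (N + m)" using pos by simp
    also have "\<dots> \<le> (N - m) / (N + m)"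
      using pos by (intro divide_right_mono) auto
    finally have "(1 - c)\<^sup>2 \<le> ((N - m) / (N + m))\<^sup>2"
      using abs_le_square_iff[of "1 - c" "(N - m) / (N + m)"] by linarith
    then show ?thesis using assms by (intro mult_left_mono) auto
  qed
  also have "\<dots> = 2 * (1 - p) * c - ((1 - p)\<^sup>2 + p * (1 - p)) * c\<^sup>2"
    unfolding mu by (simp add: power2_eq_square algebra_simps)
  finally show ?thesis .
qed

theorem theorem3:
  fixes M :: "'a measure" and \<gamma> :: "nat \<Rightarrow> 'a \<Rightarrow> real"
    and M' :: "'b measure" and \<nu> :: "nat \<Rightarrow> 'b \<Rightarrow> real"
    and a :: "real ^ 'v ^ 'v"
    and A :: "real ^ 'n ^ 'n" and B :: "real ^ 'm ^ 'n"
    and Q :: "real ^ 'n ^ 'n" and R :: "real ^ 'm ^ 'm"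
    and d :: nat and p :: real
  assumes "0 < p" and "p < 1"
    and "bernoulli_process M p \<gamma>"
    and "CARD('v) \<ge> 2" and "weighted_graph a"
    and "\<forall>z. eigenvalue (map_matrix complex_of_real A) z \<longrightarrow> cmod z \<ge> 1"
    and "rank B = CARD('m)"
    and "white_noise M' \<nu>"
    and "ms_stabilizable M' \<nu> A B 0 (matpow A d ** B)"
    and "connected_graph a"
    and "pos_def Q" and "pos_def R"
    and "gamma_2 p a > gamma_c A B d Q R"
  shows "ms_consensusable M \<gamma> a A B d p"
proof -
  interpret riccati A B d Q R
    using assms by unfold_locales
  obtain P1 where "pos_def P1" "P1 = riccati_map A B d Q R 1 P1"
    using stabilizable_imp_fixed_point[of M' \<nu>] assms unfolding D_def by blast
  then have "{g \<in> {0..1}. \<exists>P. pos_def P \<and> P = riccati_map A B d Q R g P} \<noteq> {}"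
    by force
  \<comment> \<open>The infimum need not be attained; some \<open>g\<close> of the set lies below
    \<open>gamma_2 p a\<close>.\<close>
  from cInf_lessD[OF this assms(13)[unfolded gamma_c_def]]
  obtain g P where g: "g < gamma_2 p a" and P: "pos_def P" "P = riccati_map A B d Q R g P"
    by (elim bexE CollectE conjE exE) rule
  note psd = pos_def_imp_pos_semidef[OF P(1)]
  obtain \<epsilon> where \<epsilon>: "0 < \<epsilon>" "\<And>v. \<epsilon> * (norm v)\<^sup>2 \<le> qform Q v"
    using pos_def_lower_bound[OF assms(11)] by blast
  obtain e :: "'v \<Rightarrow> real ^ 'v" and lam i0
    where ortho: "\<And>i j. e i \<bullet> e j = (if i = j then 1 else 0)"
      and eig: "\<And>i. laplacian a *v e i = lam i *\<^sub>R e i"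
      and const: "\<And>i j. e i0 $ i = e i0 $ j"
      and l2: "0 < eigval 2 (laplacian a)"
      and lam: "\<And>i. i \<noteq> i0 \<Longrightarrow> eigval 2 (laplacian a) \<le> lam i"
        "\<And>i. i \<noteq> i0 \<Longrightarrow> lam i \<le> eigval CARD('v) (laplacian a)"
    using laplacian_eigenbasis[OF assms(4,5,10)] by blast
  define \<kappa> where "\<kappa> = 2 / (eigval 2 (laplacian a) + eigval CARD('v) (laplacian a))"
  define K where "K = \<kappa> *\<^sub>R gain P"
  have K: "K *v v = \<kappa> *\<^sub>R (gain P *v v)" for v
    by (simp add: K_def scaleR_matrix_vector_assoc)
  show ?thesis
    unfolding ms_consensusable_def
  proof (intro exI[of _ K] allI impI)
    fix x0 u0 x u i j
    assume loop: "\<forall>\<omega>\<in>space M.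
      (\<forall>i. x i 0 \<omega> = x0 i \<and> (\<forall>s\<in>{1..d}. u i (- int s) \<omega> = u0 i s)) \<and>
      closed_loop a A B d p K (\<lambda>k. \<gamma> k \<omega>) (\<lambda>i k. x i k \<omega>) (\<lambda>i t. u i t \<omega>)"
    define \<xi> where "\<xi> l k \<omega> = (\<Sum>v\<in>UNIV. e l $ v *\<^sub>R x v k \<omega>)" for l k \<omega>
    define \<upsilon> where "\<upsilon> l t \<omega> = (\<Sum>v\<in>UNIV. e l $ v *\<^sub>R u v t \<omega>)" for l t \<omega>
    have null: "l2_null M (\<xi> l)" if "l \<noteq> i0" for l
    proof -
      interpret mode: delayed_mode M \<gamma> p A B d K "lam l" "\<Sum>v\<in>UNIV. e l $ v *\<^sub>R x0 v"
        "\<lambda>s. \<Sum>v\<in>UNIV. e l $ v *\<^sub>R u0 v s" "\<xi> l" "\<upsilon> l"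
      proof (intro delayed_mode.intro delayed_mode_axioms.intro)
        show "prob_space M" using assms(3) by (simp add: bernoulli_process_def)
        fix \<omega> assume \<omega>: "\<omega> \<in> space M"
        show "\<xi> l 0 \<omega> = (\<Sum>v\<in>UNIV. e l $ v *\<^sub>R x0 v)"
          using loop \<omega> by (simp add: \<xi>_def)
        show "\<upsilon> l (- int s) \<omega> = (\<Sum>v\<in>UNIV. e l $ v *\<^sub>R u0 v s)" if "s \<in> {1..d}" for s
          using loop \<omega> that by (simp add: \<upsilon>_def)
        have step: "x v (Suc k) \<omega> = A *v x v k \<omega> + \<gamma> k \<omega> *\<^sub>R (B *v u v (int k - int d) \<omega>)" for v k
          using loop \<omega> by (simp add: closed_loop_def)
        have input: "u v (int k - int d) \<omega> = K *v (\<Sum>j\<in>neighbours a v. a $ v $ j *\<^sub>R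
            (predictor A B d p (\<lambda>k. x j k \<omega>) (\<lambda>t. u j t \<omega>) k -
             predictor A B d p (\<lambda>k. x v k \<omega>) (\<lambda>t. u v t \<omega>) k))" if "d \<le> k" for v k
          using loop \<omega> that by (simp add: closed_loop_def)
        \<comment> \<open>The factor \<open>\<gamma> k \<omega>\<close> is common to all agents and
          leaves the weighted sum.\<close>
        show "\<xi> l (Suc k) \<omega> = A *v \<xi> l k \<omega> + \<gamma> k \<omega> *\<^sub>R (B *v \<upsilon> l (int k - int d) \<omega>)" for k
          by (simp add: \<xi>_def \<upsilon>_def step linear_sum[OF matrix_vector_mul_linear] matrix_vector_mult_scaleR
              scaleR_add_right sum.distrib scaleR_sum_right mult.commute)
        show "\<upsilon> l (int k - int d) \<omega> =
            - lam l *\<^sub>R (K *v predictor A B d p (\<lambda>k. \<xi> l k \<omega>) (\<lambda>t. \<upsilon> l t \<omega>) k)" if "d \<le> k" for k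
        proof -
          let ?z = "\<lambda>v. predictor A B d p (\<lambda>k. x v k \<omega>) (\<lambda>t. u v t \<omega>) k"
          have "\<upsilon> l (int k - int d) \<omega> =
              K *v (\<Sum>v\<in>UNIV. e l $ v *\<^sub>R (\<Sum>j\<in>neighbours a v. a $ v $ j *\<^sub>R (?z j - ?z v)))"
            unfolding \<upsilon>_def linear_sum[OF matrix_vector_mul_linear] matrix_vector_mult_scaleR
            by (simp add: input[OF that] linear_sum[OF matrix_vector_mul_linear] matrix_vector_mult_scaleR)
          also have "\<dots> = - lam l *\<^sub>R (K *v (\<Sum>v\<in>UNIV. e l $ v *\<^sub>R ?z v))"
            unfolding eigenvector_laplacian_sum[OF assms(5) eig] by (rule matrix_vector_mult_scaleR)
          finally show ?thesis
            by (simp only: \<xi>_def \<upsilon>_def predictor_sum)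
        qed
      qed (use assms in auto)
      have "l2_null M mode.y"
      proof (rule mode.l2_null_y[OF psd \<epsilon>(1)])
        fix v
        let ?c = "lam l * \<kappa>"
        \<comment> \<open>One \<open>g\<close> serves all modes, since \<open>gamma_2 p a\<close>
          bounds the quadratic from below at every eigenvalue other than
          \<open>lam i0\<close>.\<close>
        have "g \<le> 2 * (1 - p) * ?c - ((1 - p)\<^sup>2 + p * (1 - p)) * ?c\<^sup>2"
          using gamma_2_le[OF assms(1,2) l2 lam[OF that] refl] g unfolding \<kappa>_def by linarith
        then have "qform P (A *v v - ((1 - p) * ?c) *\<^sub>R (B *v (gain P *v v)))
            + p * (1 - p) * ?c\<^sup>2 * qform P (D *v (gain P *v v)) \<le> qform P v - qform Q v"
          using assms(1,2) by (intro mode_lyapunov[OF psd P(2)]) auto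
        then show "qform P (A *v v - ((1 - p) * lam l) *\<^sub>R (B *v (K *v v)))
            + p * (1 - p) * (lam l)\<^sup>2 * qform P (mode.D *v (K *v v)) \<le> qform P v - \<epsilon> * (norm v)\<^sup>2"
          using \<epsilon>(2)[of v]
          by (simp add: K matrix_vector_mult_scaleR qform_scaleR mode.D_def D_def power_mult_distrib mult_ac)
      qed
      then show ?thesis by (rule mode.l2_null_x)
    qed
    have recover: "(\<Sum>l\<in>UNIV. e l $ v *\<^sub>R \<xi> l k \<omega>) = x v k \<omega>" for v k \<omega>
    proof -
      have "(\<Sum>l\<in>UNIV. e l $ v *\<^sub>R \<xi> l k \<omega>) = (\<Sum>l\<in>UNIV. \<Sum>w\<in>UNIV. (e l $ v * e l $ w) *\<^sub>R x w k \<omega>)"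
        by (simp add: \<xi>_def scaleR_sum_right)
      also have "\<dots> = (\<Sum>w\<in>UNIV. (\<Sum>l\<in>UNIV. e l $ v * e l $ w) *\<^sub>R x w k \<omega>)"
        by (subst sum.swap) (simp add: scaleR_left.sum)
      also have "\<dots> = (\<Sum>w\<in>UNIV. if v = w then x w k \<omega> else 0)"
        unfolding orthonormal_basis_complete[OF ortho] by (intro sum.cong refl) simp
      finally show ?thesis by simp
    qed
    \<comment> \<open>The entries of \<open>e i0\<close> are equal, so the one mode without a decay
      estimate cancels in the difference.\<close>
    have "x j k \<omega> - x i k \<omega> = (\<Sum>l\<in>UNIV - {i0}. (e l $ j - e l $ i) *\<^sub>R \<xi> l k \<omega>)" for k \<omega>
    proof -
      have "x j k \<omega> - x i k \<omega> = (\<Sum>l\<in>UNIV. (e l $ j - e l $ i) *\<^sub>R \<xi> l k \<omega>)"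
        unfolding recover[symmetric] by (simp add: scaleR_left_diff_distrib sum_subtractf)
      also have "\<dots> = (\<Sum>l\<in>UNIV - {i0}. (e l $ j - e l $ i) *\<^sub>R \<xi> l k \<omega>)"
        by (rule sum.mono_neutral_right) (auto simp: const[of j i])
      finally show ?thesis .
    qed
    then have "l2_null M (\<lambda>k \<omega>. x j k \<omega> - x i k \<omega>)"
      by (simp only:) (intro l2_null_sum l2_null_scaleR null, simp)
    then show "ms_tendsto_zero M (\<lambda>k \<omega>. x j k \<omega> - x i k \<omega>)"
      by (rule l2_null_imp_ms_tendsto_zero)
  qed
qed

end
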